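(* Let $N\ge 11$ and let $f$ satisfy the standing assumptions given in the context. Assume that the finite limit $q_\infty=\lim_{u\to\infty}f'(u)F(u)$ exists and that $q_\infty>q_{JL}$. Then there exists $\hat\alpha>0$ such that $u(r,\alpha)$ is unstable for $\alpha>\hat\alpha$, and hence one of the following holds: (I) for any $\alpha>0$, $u(r,\alpha)$ is unstable; or (III) there exists $\alpha^*\in(0,\infty)$ such that $u(r,\alpha)$ is stable if $\alpha\in(0,\alpha^*]$ and unstable if $\alpha>\alpha^*$, and $u(r,\alpha)$ is strictly increasing in $\alpha\in(0,\alpha^* )$ for each fixed $r>0$.
   Context: Standing assumptions on $f:\mathbb{R}\to\mathbb{R}$: $f\in C^2(\mathbb{R}\setminus\{0\})\cap C^1(\mathbb{R})$; $f$ is odd (so $f(0)=0$); and for all $u>0$, $f(u)>0$, $f'(u)>0$, $f''(u)>0$ and $F(u):=\int_u^\infty \frac{ds}{f(s)}<\infty$. $q_{JL}:=\frac{N-2\sqrt{N-1}}{4}$. For $\alpha>0$, $u(r,\alpha)$ denotes the unique solution of $u''+\frac{N-1}{r}u'+f(u)=0$ for $r>0$, $u(0)=\alpha$, $u'(0)=0$. A solution $u\in C^2(\mathbb{R}^N)$ of $\Delta u+f(u)=0$ in $\mathbb{R}^N$ is called stable if $\int_{\mathbb{R}^N}(|\nabla\phi|^2-f'(u)\phi^2)\,dx\ge 0$ for every $\phi\in C^1_0(\mathbb{R}^N)$ ($C^1$ functions with compact support), and unstable if it is not stable. We say $u(r,\alpha)$ is stable (unstable) if $x\mapsto u(|x|,\alpha)$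 is. *)

theory Defs
  imports "HOL-Analysis.Analysis"
begin

definition C1_fun :: "(real \<Rightarrow> real) \<Rightarrow> bool" where
  "C1_fun f \<longleftrightarrow> (\<forall>x. f differentiable (at x)) \<and> continuous_on UNIV (deriv f)"

definition C2_off_zero :: "(real \<Rightarrow> real) \<Rightarrow> bool" where
  "C2_off_zero f \<longleftrightarrow>
     (\<forall>x. x \<noteq> 0 \<longrightarrow> f differentiable (at x) \<and> deriv f differentiable (at x)) \<and>
     continuous_on (- {0}) (deriv (deriv f))"

text \<open>Since \<open>f > 0\<close> on the positive axis, integrability of \<open>1 / f\<close> on \<open>{u..}\<close> says exactly
  that the integral defining \<open>F u\<close> is finite.\<close>

definition standing_assumptions :: "(real \<Rightarrow> real) \<Rightarrow> bool" where
  "standing_assumptions f \<longleftrightarrow>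
     C2_off_zero f \<and> C1_fun f \<and> (\<forall>u. f (- u) = - f u) \<and>
     (\<forall>u>0. f u > 0 \<and> deriv f u > 0 \<and> deriv (deriv f) u > 0 \<and>
            set_integrable lborel {u..} (\<lambda>s. 1 / f s))"

definition F_int :: "(real \<Rightarrow> real) \<Rightarrow> real \<Rightarrow> real" where
  "F_int f u = (LBINT s:{u..}. 1 / f s)"

definition q_JL :: "nat \<Rightarrow> real" where
  "q_JL N = (real N - 2 * sqrt (real N - 1)) / 4"

text \<open>The derivative at \<open>0\<close> is one-sided. Continuity of \<open>u\<close> at \<open>0\<close> is implied by
  differentiability there, and continuity of \<open>u''\<close> on \<open>r > 0\<close> by the equation.\<close>

definition is_radial_solution ::
  "nat \<Rightarrow> (real \<Rightarrow> real) \<Rightarrow> real \<Rightarrow> (real \<Rightarrow> real) \<Rightarrow> bool" where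
  "is_radial_solution N f \<alpha> u \<longleftrightarrow>
     (\<exists>u' u''.
        (\<forall>r\<ge>0. (u has_real_derivative u' r) (at r within {0..})) \<and>
        (\<forall>r>0. (u' has_real_derivative u'' r) (at r)) \<and>
        (\<forall>r>0. u'' r + (real N - 1) / r * u' r + f (u r) = 0) \<and>
        u 0 = \<alpha> \<and> u' 0 = 0)"

text \<open>The solution lives on \<open>r \<ge> 0\<close>; its values at \<open>r < 0\<close> are fixed to \<open>0\<close> only so that
  it is unique as a total function.\<close>

definition radial_sol :: "nat \<Rightarrow> (real \<Rightarrow> real) \<Rightarrow> real \<Rightarrow> real \<Rightarrow> real" where
  "radial_sol N f \<alpha> = (THE u. is_radial_solution N f \<alpha> u \<and> (\<forall>r<0. u r = 0))"

definition C1_compact_support ::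
  "(real ^ 'n::finite \<Rightarrow> real) \<Rightarrow> (real ^ 'n \<Rightarrow> real ^ 'n) \<Rightarrow> bool" where
  \<comment> \<open>\<open>\<phi>\<close> is a \<open>C\<^sup>1\<close> function with compact support and gradient \<open>g\<close>\<close>
  "C1_compact_support \<phi> g \<longleftrightarrow>
     (\<forall>x. GDERIV \<phi> x :> g x) \<and> continuous_on UNIV g \<and> compact (closure {x. \<phi> x \<noteq> 0})"

definition stable :: "(real \<Rightarrow> real) \<Rightarrow> (real ^ 'n::finite \<Rightarrow> real) \<Rightarrow> bool" where
  "stable f u \<longleftrightarrow>
     (\<forall>\<phi> g. C1_compact_support \<phi> g \<longrightarrow>
        (LBINT x. (norm (g x))\<^sup>2 - deriv f (u x) * (\<phi> x)\<^sup>2) \<ge> 0)"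

abbreviation unstable :: "(real \<Rightarrow> real) \<Rightarrow> (real ^ 'n::finite \<Rightarrow> real) \<Rightarrow> bool" where
  "unstable f u \<equiv> \<not> stable f u"

definition radial_fun :: "(real \<Rightarrow> real) \<Rightarrow> real \<Rightarrow> real ^ 'n::finite \<Rightarrow> real" where
  "radial_fun f \<alpha> x = radial_sol CARD('n) f \<alpha> (norm x)"

end

theory Submission
  imports Defs
begin

text \<open>
  Ordering: if \<open>u(\<cdot>,\<alpha>)\<close> is stable and \<open>\<beta> < \<alpha>\<close>, then \<open>0 < u(\<cdot>,\<beta>) < u(\<cdot>,\<alpha>)\<close>. Otherwise, up to the first
  radius where this fails, \<open>w = u(\<cdot>,\<beta>)\<close> or \<open>w = u(\<cdot>,\<alpha>) - u(\<cdot>,\<beta>)\<close> is positive, vanishes at the end, and by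
  convexity satisfies \<open>- \<Delta> w < f'(u(\<cdot>,\<alpha>)) w\<close>, so (a \<open>C\<^sup>1\<close> regularisation of) \<open>w\<close> violates stability. As \<open>f'\<close>
  increases on the positive axis, stability passes to smaller \<open>\<alpha>\<close>; by continuous dependence it passes to
  limits. So the stable values of \<open>\<alpha>\<close> form a set \<open>(0, \<alpha>*]\<close>, unless it is empty or unbounded.

  Instability for large \<open>\<alpha>\<close>: testing with \<open>h = u' \<zeta>\<close> turns stability into
  \<open>(N - 1) \<integral> u'\<^sup>2 \<zeta>\<^sup>2 r\<^sup>N\<^sup>-\<^sup>3 \<le> \<integral> u'\<^sup>2 \<zeta>'\<^sup>2 r\<^sup>N\<^sup>-\<^sup>1\<close>. A \<open>\<zeta>\<close> that behaves like \<open>r\<close> for \<open>r \<le> \<epsilon>\<close>, like \<open>r\<close> to the power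
  \<open>- \<surd>(N - 1)\<close> on \<open>[\<epsilon>, 1]\<close> and is cut off on \<open>[1, 2]\<close> shows that \<open>f(\<alpha>)\<^sup>2\<close> times \<open>\<epsilon>\<close> to the power \<open>4 q\<^sub>J\<^sub>L\<close> is bounded
  by a constant: for \<open>\<epsilon>\<^sup>2\<close> a small multiple of \<open>F(\<alpha>)\<close> one has \<open>f(u) \<ge> f(\<alpha>)/2\<close> on \<open>[0, \<epsilon>]\<close>, and
  \<open>F(u(1)) \<ge> 1/(2N)\<close> bounds \<open>u\<close> and \<open>u'\<close> on \<open>[1, 2]\<close> independently of \<open>\<alpha>\<close>. But \<open>f\<close> times \<open>F\<close> to the power \<open>q\<^sub>J\<^sub>L\<close>
  tends to infinity when \<open>q\<^sub>\<infinity> > q\<^sub>J\<^sub>L\<close>.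
\<close>

section \<open>Radial averages and the integral equation\<close>

text \<open>For g = f(u) this is -u' of a radial solution u: the equation in divergence form reads
  (r^(N-1) u')' = - r^(N-1) f(u), and it has been integrated from 0. At r = 0 the integral over a
  point gives the value 0.\<close>

definition radial_avg :: "nat \<Rightarrow> (real \<Rightarrow> real) \<Rightarrow> real \<Rightarrow> real" where
  "radial_avg N g r = integral {0..r} (\<lambda>t. t ^ (N - 1) * g t) / r ^ (N - 1)"

lemma integral_has_real_derivative_at:
  fixes k :: "real \<Rightarrow> real"
  assumes "continuous_on {0..} k" "r > 0"
  shows "((\<lambda>x. integral {0..x} k) has_real_derivative k r) (at r)"
proof -
  have "((\<lambda>x. integral {0..x} k) has_real_derivative k r) (at r within {0..r+1})"
    using assms by (intro integral_has_real_derivative continuous_on_subset[OF assms(1)]) auto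
  moreover have "at r within {0..r+1} = at r"
    using assms by (intro at_within_interior) auto
  ultimately show ?thesis by simp
qed

lemma integral_has_real_derivative_atLeast:
  fixes k :: "real \<Rightarrow> real"
  assumes "continuous_on {0..} k" "r \<ge> 0"
  shows "((\<lambda>x. integral {0..x} k) has_real_derivative k r) (at r within {0..})"
proof -
  have "((\<lambda>x. integral {0..x} k) has_real_derivative k r) (at r within {0..r+1})"
    using assms by (intro integral_has_real_derivative continuous_on_subset[OF assms(1)]) auto
  moreover have "at r within {0..r+1} = at r within {0..}"
    by (rule at_within_nhd[of _ "{..<r+1}"]) auto
  ultimately show ?thesis by simp
qed

lemma continuous_on_integral_atLeast:
  fixes k :: "real \<Rightarrow> real"
  assumes "continuous_on {0..} k"
  shows "continuous_on {0..} (\<lambda>x. integral {0..x} k)"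
  using integral_has_real_derivative_atLeast[OF assms]
  by (intro DERIV_continuous_on) auto

lemma radial_avg_0 [simp]: "radial_avg N g 0 = 0"
  by (simp add: radial_avg_def)

lemma continuous_on_weighted:
  "continuous_on {0..} g \<Longrightarrow> continuous_on {0..} (\<lambda>t::real. t ^ m * g t :: real)"
  by (intro continuous_intros)

lemma integrable_on_weighted:
  "continuous_on {0..} g \<Longrightarrow> (\<lambda>t::real. t ^ m * g t :: real) integrable_on {0..r}"
  by (intro integrable_continuous_real continuous_on_subset[OF continuous_on_weighted]) auto

text \<open>With u' = -V this first-order equation V' + (N-1)/r V = g is the radial form of -
  Laplacian u = g.\<close>

lemma radial_avg_deriv:
  assumes "continuous_on {0..} g" "r > 0" "N \<ge> 1"
  shows "(radial_avg N g has_real_derivative g r - (real N - 1) / r * radial_avg N g r) (at r)"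
proof -
  have "((\<lambda>r. integral {0..r} (\<lambda>t. t ^ (N - 1) * g t)) has_real_derivative r ^ (N - 1) * g r) (at r)"
    by (rule integral_has_real_derivative_at[OF continuous_on_weighted[OF assms(1)] assms(2)])
  then have "(radial_avg N g has_real_derivative
     ((r ^ (N - 1) * g r) * r ^ (N - 1) - integral {0..r} (\<lambda>t. t ^ (N - 1) * g t) * (real (N - 1) * r ^ (N - 1 - 1)))
       / (r ^ (N - 1) * r ^ (N - 1))) (at r)"
    unfolding radial_avg_def using assms(2)
    by (auto intro!: derivative_eq_intros)
  moreover have "((r ^ (N - 1) * g r) * r ^ (N - 1) - integral {0..r} (\<lambda>t. t ^ (N - 1) * g t) * (real (N - 1) * r ^ (N - 1 - 1)))
       / (r ^ (N - 1) * r ^ (N - 1)) = g r - (real N - 1) / r * radial_avg N g r"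
  proof (cases "N = 1")
    case True then show ?thesis by (simp add: radial_avg_def)
  next
    case False
    then have m: "Suc (N - 2) = N - 1" "N - 1 - 1 = N - 2" "real (N - 1) = real N - 1" using assms(3) by auto
    have "(r ^ Suc k * a * r ^ Suc k - b * (real (Suc k) * r ^ k)) / (r ^ Suc k * r ^ Suc k)
       = a - real (Suc k) / r * (b / r ^ Suc k)" for k a b
      using assms(2) by (simp add: divide_simps) (simp add: algebra_simps)
    from this[of "N - 2" "g r" "integral {0..r} (\<lambda>t. t ^ (N - 1) * g t)"] show ?thesis
      unfolding m radial_avg_def .
  qed
  ultimately show ?thesis by simp
qed

text \<open>A constant B gives exactly B r / N, and the weight t^(N-1) is nonnegative.\<close>

lemma radial_avg_le:
  assumes "continuous_on {0..} g" "\<And>t. 0 \<le> t \<Longrightarrow> t \<le> r \<Longrightarrow> g t \<le> B" "0 \<le> r" "N \<ge> 1"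
  shows "radial_avg N g r \<le> B * r / real N"
proof (cases "r = 0")
  case False
  then have r: "r > 0" using assms by simp
  have "((\<lambda>t. B * t ^ (N - 1)) has_integral (B * r ^ N / real N - B * 0 ^ N / real N)) {0..r}"
    using assms
    by (intro fundamental_theorem_of_calculus)
      (auto intro!: derivative_eq_intros simp: has_real_derivative_iff_has_vector_derivative[symmetric])
  then have i: "((\<lambda>t. B * t ^ (N - 1)) has_integral (B * r ^ N / real N)) {0..r}"
    using assms(4) by (simp add: zero_power)
  have "integral {0..r} (\<lambda>t. t ^ (N - 1) * g t) \<le> integral {0..r} (\<lambda>t. B * t ^ (N - 1))"
  proof (rule integral_le[OF integrable_on_weighted[OF assms(1)]])
    show "(\<lambda>t. B * t ^ (N - 1)) integrable_on {0..r}" using i by blast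
    fix t assume "t \<in> {0..r}"
    then show "t ^ (N - 1) * g t \<le> B * t ^ (N - 1)"
      using assms(2)[of t] by (simp add: mult.commute mult_right_mono)
  qed
  also have "\<dots> = B * r ^ N / real N" using i by (rule integral_unique)
  also have "r ^ N = r * r ^ (N - 1)" using assms(4) by (metis Suc_pred' less_eq_Suc_le power_Suc One_nat_def)
  finally show ?thesis using r by (simp add: radial_avg_def field_simps)
qed simp

lemma radial_avg_minus: "radial_avg N (\<lambda>t. - g t) r = - radial_avg N g r"
  by (simp add: radial_avg_def)

lemma radial_avg_diff:
  assumes "continuous_on {0..} g" "continuous_on {0..} h"
  shows "radial_avg N (\<lambda>t. g t - h t) r = radial_avg N g r - radial_avg N h r"
  using integral_diff[OF integrable_on_weighted[OF assms(1), of "N-1" r] integrable_on_weighted[OF assms(2), of "N-1" r]]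
  by (simp only: radial_avg_def right_diff_distrib diff_divide_distrib)

lemma radial_avg_cong:
  assumes "\<And>t. 0 \<le> t \<Longrightarrow> t \<le> r \<Longrightarrow> g t = h t"
  shows "radial_avg N g r = radial_avg N h r"
  using assms by (auto simp: radial_avg_def intro!: integral_cong)

lemma radial_avg_ge:
  assumes "continuous_on {0..} g" "\<And>t. 0 \<le> t \<Longrightarrow> t \<le> r \<Longrightarrow> B \<le> g t" "0 \<le> r" "N \<ge> 1"
  shows "B * r / real N \<le> radial_avg N g r"
  using radial_avg_le[of "\<lambda>t. - g t" r "-B" N] assms
  by (simp add: radial_avg_minus continuous_on_minus)

text \<open>For r > 0 differentiability suffices; at 0 the function is squeezed by B t / N, where B
  bounds |g| on [0, 1].\<close>

lemma continuous_on_radial_avg: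
  assumes "continuous_on {0..} g" "N \<ge> 1"
  shows "continuous_on {0..} (radial_avg N g)"
  unfolding continuous_on_eq_continuous_within
proof
  fix r :: real assume "r \<in> {0..}"
  show "continuous (at r within {0..}) (radial_avg N g)"
  proof (cases "r = 0")
    case False
    then show ?thesis
      using radial_avg_deriv[OF assms(1) _ assms(2), of r] \<open>r \<in> {0..}\<close>
      by (auto intro!: continuous_at_imp_continuous_at_within DERIV_isCont)
  next
    case True
    have "compact (g ` {0..1})"
      by (intro compact_continuous_image continuous_on_subset[OF assms(1)]) auto
    then obtain B where B: "\<And>t. 0 \<le> t \<Longrightarrow> t \<le> 1 \<Longrightarrow> \<bar>g t\<bar> \<le> B"
      using compact_imp_bounded[of "g ` {0..1}"] unfolding bounded_iff by (metis atLeastAtMost_iff image_eqI real_norm_def)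
    have "\<bar>radial_avg N g t\<bar> \<le> B * t / real N" if "0 \<le> t" "t \<le> 1" for t
      using radial_avg_le[OF assms(1), of t B] radial_avg_ge[OF assms(1), of t "-B"] B that assms(2)
      by (smt (verit, best) mult_minus_left minus_divide_left)
    then have "\<forall>\<^sub>F t in at 0 within {0..}. norm (radial_avg N g t) \<le> B * t / real N"
      unfolding eventually_at by (intro exI[of _ 1]) (auto simp: dist_real_def)
    moreover have "((\<lambda>t. B * t / real N) \<longlongrightarrow> B * 0 / real N) (at 0 within {0..})"
      using assms(2) by (intro tendsto_intros) auto
    then have "((\<lambda>t. B * t / real N) \<longlongrightarrow> 0) (at 0 within {0..})" by simp
    ultimately have "(radial_avg N g \<longlongrightarrow> 0) (at 0 within {0..})"
      by (rule Lim_null_comparison)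
    then show ?thesis using True by (simp add: continuous_within)
  qed
qed

section \<open>Exponentially weighted bounds and the Volterra fixed point\<close>

lemma integral_exp_le:
  fixes l :: real
  assumes "l > 0" "0 \<le> r" "0 \<le> D"
  shows "integral {0..r} (\<lambda>t. D * exp (l * t)) \<le> D * exp (l * r) / l"
proof -
  have "((\<lambda>t. D * exp (l * t)) has_integral (D * exp (l * r) / l - D * exp (l * 0) / l)) {0..r}"
    using assms
    by (intro fundamental_theorem_of_calculus)
      (auto intro!: derivative_eq_intros simp: has_real_derivative_iff_has_vector_derivative[symmetric])
  then have "integral {0..r} (\<lambda>t. D * exp (l * t)) = D * exp (l * r) / l - D * exp (l * 0) / l"
    by (rule integral_unique)
  then show ?thesis using assms by simp
qed

text \<open>As t^(N-1) <= r^(N-1), the weight drops out, and integrating exp(l t) gains a factor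
  1/l. A second integration, in the next lemma, gains another 1/l; this is what makes the fixed
  point map contract for large l.\<close>

lemma radial_avg_exp_bound:
  assumes "continuous_on {0..} g" "\<And>t. 0 \<le> t \<Longrightarrow> t \<le> r \<Longrightarrow> \<bar>g t\<bar> \<le> D * exp (l * t)"
    "0 \<le> r" "0 < l"
  shows "\<bar>radial_avg N g r\<bar> \<le> D * exp (l * r) / l"
proof (cases "r = 0")
  case True
  then show ?thesis using assms(2)[of 0] assms(4) by (simp add: order_trans[OF abs_ge_zero])
next
  case False
  then have r: "r > 0" using assms by simp
  have D: "0 \<le> D" using assms(2)[of 0] assms(3) by simp
  have "norm (integral {0..r} (\<lambda>t. t ^ (N - 1) * g t)) \<le> integral {0..r} (\<lambda>t. (r ^ (N - 1) * D) * exp (l * t))"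
  proof (rule integral_norm_bound_integral[OF integrable_on_weighted[OF assms(1)]])
    show "(\<lambda>t. (r ^ (N - 1) * D) * exp (l * t)) integrable_on {0..r}"
      by (intro integrable_continuous_real continuous_intros)
    fix t assume t: "t \<in> {0..r}"
    then have "t ^ (N - 1) * \<bar>g t\<bar> \<le> r ^ (N - 1) * (D * exp (l * t))"
      using assms(2)[of t] by (intro mult_mono power_mono) auto
    then show "norm (t ^ (N - 1) * g t) \<le> (r ^ (N - 1) * D) * exp (l * t)"
      using t by (simp add: abs_mult algebra_simps)
  qed
  also have "\<dots> \<le> (r ^ (N - 1) * D) * exp (l * r) / l"
    using assms D by (intro integral_exp_le) auto
  finally show ?thesis using r assms(4) by (simp add: radial_avg_def field_simps)
qed

lemma integral_radial_avg_exp_bound: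
  assumes "continuous_on {0..} g" "\<And>t. 0 \<le> t \<Longrightarrow> t \<le> r \<Longrightarrow> \<bar>g t\<bar> \<le> D * exp (l * t)"
    "0 \<le> r" "0 < l" "N \<ge> 1"
  shows "\<bar>integral {0..r} (radial_avg N g)\<bar> \<le> D * exp (l * r) / l\<^sup>2"
proof -
  have D: "0 \<le> D" using assms(2)[of 0] assms(3) by simp
  have "norm (integral {0..r} (radial_avg N g)) \<le> integral {0..r} (\<lambda>t. D / l * exp (l * t))"
  proof (rule integral_norm_bound_integral)
    show "radial_avg N g integrable_on {0..r}"
      by (intro integrable_continuous_real continuous_on_subset[OF continuous_on_radial_avg[OF assms(1,5)]]) auto
    show "(\<lambda>t. D / l * exp (l * t)) integrable_on {0..r}"
      by (intro integrable_continuous_real continuous_intros)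
    fix t assume "t \<in> {0..r}"
    then show "norm (radial_avg N g t) \<le> D / l * exp (l * t)"
      using radial_avg_exp_bound[OF assms(1), of t D l N] assms by auto
  qed
  also have "\<dots> \<le> D / l * exp (l * r) / l"
    using assms D by (intro integral_exp_le) auto
  finally show ?thesis by (simp add: power2_eq_square)
qed

text \<open>Banach's fixed point theorem for w(t) = exp(-l t) u(t) in the space of bounded
  continuous functions. The two integrations give the contraction factor L / l^2, so one application
  yields u on the whole half-line.\<close>

lemma volterra_existence:
  fixes \<phi> :: "real \<Rightarrow> real"
  assumes lip: "\<And>x y. \<bar>\<phi> x - \<phi> y\<bar> \<le> L * \<bar>x - y\<bar>" and N: "N \<ge> 1"
  obtains u where "continuous_on {0..} u"
    "\<And>r. 0 \<le> r \<Longrightarrow> u r = \<alpha> - integral {0..r} (radial_avg N (\<lambda>t. \<phi> (u t)))"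
proof -
  \<comment> \<open>Chosen so that L / l^2 <= 1/2, since (L + 1)^2 >= 2 L.\<close>
  define l where "l = L + 1"
  have L: "L \<ge> 0" using lip[of 1 0] by simp
  have l: "l > 0" "L \<le> l\<^sup>2 / 2" using L by (auto simp: l_def power2_eq_square algebra_simps)
  have "L-lipschitz_on UNIV \<phi>"
    using lip L by (auto simp: lipschitz_on_def dist_real_def)
  then have cphi: "continuous_on UNIV \<phi>" by (rule lipschitz_on_continuous_on)
  define G where "G w = (\<lambda>t. \<phi> (exp (l * t) * apply_bcontfun w t))" for w :: "real \<Rightarrow>\<^sub>C real"
  have contG: "continuous_on A (G w)" for w A
    unfolding G_def
    by (intro continuous_on_compose2[OF cphi] continuous_intros) auto
  \<comment> \<open>The function space lives on all of the real line, so the image is continued as a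
    constant to r < 0 through \<open>max r 0\<close>.\<close>
  define T0 where "T0 w = (\<lambda>r. exp (- l * max r 0) * (\<alpha> - integral {0..max r 0} (radial_avg N (G w))))" for w
  have contI: "continuous_on {0..} (\<lambda>r. integral {0..r} (radial_avg N (G w)))" for w
    by (intro continuous_on_integral_atLeast continuous_on_radial_avg contG N)
  have contT: "continuous_on UNIV (T0 w)" for w
    unfolding T0_def
    by (intro continuous_intros continuous_on_compose2[OF contI[of w]]) auto
  have boundT: "\<bar>T0 w r\<bar> \<le> \<bar>\<alpha>\<bar> + (\<bar>\<phi> 0\<bar> + L * norm w) / l\<^sup>2" for w r
  proof -
    define s where "s = max r 0"
    have s: "s \<ge> 0" by (simp add: s_def)
    have "\<bar>integral {0..s} (radial_avg N (G w))\<bar> \<le> (\<bar>\<phi> 0\<bar> + L * norm w) * exp (l * s) / l\<^sup>2"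
    proof (rule integral_radial_avg_exp_bound[OF contG _ s l(1) N])
      fix t :: real assume t: "0 \<le> t" "t \<le> s"
      have "\<bar>G w t\<bar> \<le> \<bar>\<phi> 0\<bar> + L * \<bar>exp (l * t) * apply_bcontfun w t\<bar>"
        using lip[of "exp (l * t) * apply_bcontfun w t" 0] by (simp add: G_def)
      also have "\<dots> \<le> \<bar>\<phi> 0\<bar> * exp (l * t) + L * (exp (l * t) * norm w)"
      proof (intro add_mono mult_left_mono)
        have "1 \<le> exp (l * t)" using t l by simp
        then have "\<bar>\<phi> 0\<bar> * 1 \<le> \<bar>\<phi> 0\<bar> * exp (l * t)" by (intro mult_left_mono) auto
        then show "\<bar>\<phi> 0\<bar> \<le> \<bar>\<phi> 0\<bar> * exp (l * t)" by simp
        show "\<bar>exp (l * t) * apply_bcontfun w t\<bar> \<le> exp (l * t) * norm w"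
          using norm_bounded[of w t] by (simp add: abs_mult)
      qed (use L in auto)
      finally show "\<bar>G w t\<bar> \<le> (\<bar>\<phi> 0\<bar> + L * norm w) * exp (l * t)" by (simp add: algebra_simps)
    qed
    then have "exp (- l * s) * \<bar>integral {0..s} (radial_avg N (G w))\<bar> \<le> exp (- l * s) * ((\<bar>\<phi> 0\<bar> + L * norm w) * exp (l * s) / l\<^sup>2)"
      by (intro mult_left_mono) auto
    also have "\<dots> = (\<bar>\<phi> 0\<bar> + L * norm w) / l\<^sup>2" by (simp add: exp_minus)
    finally have 1: "exp (- l * s) * \<bar>integral {0..s} (radial_avg N (G w))\<bar> \<le> (\<bar>\<phi> 0\<bar> + L * norm w) / l\<^sup>2" .
    have "\<bar>T0 w r\<bar> = exp (- l * s) * \<bar>\<alpha> - integral {0..s} (radial_avg N (G w))\<bar>"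
      by (simp add: T0_def s_def abs_mult)
    also have "\<dots> \<le> exp (- l * s) * (\<bar>\<alpha>\<bar> + \<bar>integral {0..s} (radial_avg N (G w))\<bar>)"
      by (intro mult_left_mono) auto
    also have "\<dots> = exp (- l * s) * \<bar>\<alpha>\<bar> + exp (- l * s) * \<bar>integral {0..s} (radial_avg N (G w))\<bar>"
      by (simp add: algebra_simps)
    also have "exp (- l * s) * \<bar>\<alpha>\<bar> \<le> \<bar>\<alpha>\<bar>" using s l
      by (intro mult_left_le_one_le) auto
    finally show ?thesis using 1 by linarith
  qed
  have memT: "T0 w \<in> bcontfun" for w
  proof -
    have "bounded (range (T0 w))"
      unfolding bounded_iff using boundT[of w] by (metis rangeE real_norm_def)
    then show ?thesis using contT[of w] by (simp add: bcontfun_def)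
  qed
  define T where "T w = Bcontfun (T0 w)" for w
  have appT: "apply_bcontfun (T w) r = T0 w r" for w r
    using memT by (simp add: T_def Bcontfun_inverse)
  have contr: "dist (T w) (T z) \<le> 1/2 * dist w z" for w z
  proof (rule dist_bound)
    fix r :: real
    define s where "s = max r 0"
    have s: "s \<ge> 0" by (simp add: s_def)
    have dG: "\<bar>G w t - G z t\<bar> \<le> (L * dist w z) * exp (l * t)" for t
    proof -
      have "\<bar>G w t - G z t\<bar> \<le> L * \<bar>exp (l * t) * apply_bcontfun w t - exp (l * t) * apply_bcontfun z t\<bar>"
        unfolding G_def by (rule lip)
      also have "exp (l * t) * apply_bcontfun w t - exp (l * t) * apply_bcontfun z t
          = exp (l * t) * (apply_bcontfun w t - apply_bcontfun z t)" by (simp add: algebra_simps)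
      also have "L * \<bar>\<dots>\<bar> \<le> L * (exp (l * t) * dist w z)"
        using L dist_bounded[of w t z] by (intro mult_left_mono) (auto simp: abs_mult dist_real_def)
      finally show ?thesis by (simp add: algebra_simps)
    qed
    have "(\<lambda>t. radial_avg N (\<lambda>t. G w t - G z t) t) = (\<lambda>t. radial_avg N (G w) t - radial_avg N (G z) t)"
      by (simp add: radial_avg_diff contG)
    then have eq: "integral {0..s} (radial_avg N (\<lambda>t. G w t - G z t))
        = integral {0..s} (radial_avg N (G w)) - integral {0..s} (radial_avg N (G z))"
      by (simp add: integral_diff integrable_continuous_real
          continuous_on_subset[OF continuous_on_radial_avg[OF contG N]])
    have "\<bar>integral {0..s} (radial_avg N (\<lambda>t. G w t - G z t))\<bar> \<le> (L * dist w z) * exp (l * s) / l\<^sup>2"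
      using dG by (intro integral_radial_avg_exp_bound continuous_intros contG s l N)
    then have "exp (- l * s) * \<bar>integral {0..s} (radial_avg N (\<lambda>t. G w t - G z t))\<bar>
      \<le> exp (- l * s) * ((L * dist w z) * exp (l * s) / l\<^sup>2)"
      by (intro mult_left_mono) auto
    also have "\<dots> = L / l\<^sup>2 * dist w z" by (simp add: exp_minus)
    also have "\<dots> \<le> 1/2 * dist w z"
      using l by (intro mult_right_mono) (auto simp: field_simps)
    finally have "exp (- l * s) * \<bar>integral {0..s} (radial_avg N (G w)) - integral {0..s} (radial_avg N (G z))\<bar> \<le> 1/2 * dist w z"
      unfolding eq .
    moreover have "dist (T0 w r) (T0 z r) = exp (- l * s) * \<bar>integral {0..s} (radial_avg N (G w)) - integral {0..s} (radial_avg N (G z))\<bar>"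
    proof -
      have "T0 w r - T0 z r = exp (- l * s) * (integral {0..s} (radial_avg N (G z)) - integral {0..s} (radial_avg N (G w)))"
        by (simp add: T0_def s_def algebra_simps)
      then show ?thesis by (simp add: dist_real_def abs_mult abs_minus_commute)
    qed
    ultimately show "dist (apply_bcontfun (T w) r) (apply_bcontfun (T z) r) \<le> 1/2 * dist w z"
      by (simp add: appT)
  qed
  have "\<exists>!w. T w = w"
    by (rule banach_fix_type[where c="1/2"]) (use contr in auto)
  then obtain w where w: "T w = w" by auto
  define u where "u = (\<lambda>t. exp (l * t) * apply_bcontfun w t)"
  show ?thesis
  proof
    show "continuous_on {0..} u" unfolding u_def by (intro continuous_intros) auto
    fix r :: real assume r: "0 \<le> r"
    have "u r = exp (l * r) * T0 w r" using appT[of w r] w by (simp add: u_def)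
    also have "\<dots> = \<alpha> - integral {0..r} (radial_avg N (G w))"
      using r by (simp add: T0_def exp_minus)
    also have "G w = (\<lambda>t. \<phi> (u t))" by (simp add: G_def u_def)
    finally show "u r = \<alpha> - integral {0..r} (radial_avg N (\<lambda>t. \<phi> (u t)))" .
  qed
qed

section \<open>Radial solutions\<close>

lemma at_within_atLeast_0: "r > 0 \<Longrightarrow> at r within {0..} = at (r::real)"
  by (rule at_within_open_subset[of _ "{0<..}"]) auto

text \<open>The notion of solution does not include continuity of u' at 0. The mean value theorem on
  [0, 1/(n+1)] provides points at which u' equals difference quotients at 0, and this sequence
  replaces the missing continuity.\<close>

lemma radial_derivative_sequence:
  fixes u :: "real \<Rightarrow> real"
  assumes u: "\<And>r. r \<ge> 0 \<Longrightarrow> (u has_real_derivative u' r) (at r within {0..})"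
  obtains \<xi> :: "nat \<Rightarrow> real" where "\<And>n. 0 < \<xi> n" "\<xi> \<longlonglongrightarrow> 0" "(\<lambda>n. u' (\<xi> n)) \<longlonglongrightarrow> u' 0"
proof -
  have cont: "continuous_on {0..} u" using u by (intro DERIV_continuous_on) auto
  have "\<exists>x>0. x < h \<and> u' x = (u h - u 0) / h" if "h > 0" for h
  proof -
    have "\<exists>l z. z > 0 \<and> z < h \<and> (u has_real_derivative l) (at z) \<and> u h - u 0 = (h - 0) * l"
    proof (rule MVT[OF that])
      show "continuous_on {0..h} u" by (rule continuous_on_subset[OF cont]) auto
      fix x assume "0 < x" "x < h"
      then show "u differentiable (at x)"
        using u[of x] by (auto simp: at_within_atLeast_0 real_differentiable_def)
    qed
    then obtain l z where z: "z > 0" "z < h" "(u has_real_derivative l) (at z)" "u h - u 0 = h * l" by auto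
    then have "l = u' z" using u[of z] by (auto simp: at_within_atLeast_0 intro: DERIV_unique)
    then show ?thesis using z that by (intro exI[of _ z]) auto
  qed
  then have "\<exists>x>0. x < inverse (real (Suc n)) \<and> u' x = (u (inverse (real (Suc n))) - u 0) / inverse (real (Suc n))" for n
    by simp
  then obtain \<xi> where \<xi>: "\<And>n. 0 < \<xi> n" "\<And>n. \<xi> n < inverse (real (Suc n))"
    "\<And>n. u' (\<xi> n) = (u (inverse (real (Suc n))) - u 0) / inverse (real (Suc n))" by metis
  have lim: "(\<lambda>n. inverse (real (Suc n))) \<longlonglongrightarrow> 0" by (rule LIMSEQ_inverse_real_of_nat)
  show ?thesis
  proof
    show "\<xi> \<longlonglongrightarrow> 0"
      by (rule tendsto_sandwich[OF _ _ tendsto_const lim]) (use \<xi> in \<open>auto intro!: always_eventually less_imp_le\<close>)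
    have "((\<lambda>h. (u h - u 0) / (h - 0)) \<longlongrightarrow> u' 0) (at 0 within {0..})"
      using u[of 0] by (simp add: has_field_derivative_iff)
    moreover have "filterlim (\<lambda>n. inverse (real (Suc n))) (at 0 within {0..}) sequentially"
      using lim by (auto simp: filterlim_at)
    ultimately have "(\<lambda>n. (u (inverse (real (Suc n))) - u 0) / (inverse (real (Suc n)) - 0)) \<longlonglongrightarrow> u' 0"
      by (rule filterlim_compose)
    then show "(\<lambda>n. u' (\<xi> n)) \<longlonglongrightarrow> u' 0" unfolding \<xi>(3) by simp
  qed (use \<xi> in auto)
qed

text \<open>The energy u'^2/2 + G(u), with G a primitive of g, does not increase in r, because its
  derivative is -(N-1)/r u'^2. Its initial value is G(\<alpha>), and G is even and strictly
  increasing on the positive axis.\<close>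

lemma radial_solution_bound:
  fixes g :: "real \<Rightarrow> real"
  assumes sol: "is_radial_solution N g \<alpha> u"
    and g: "continuous_on UNIV g" "\<And>x. g (- x) = - g x" "\<And>x. x > 0 \<Longrightarrow> g x > 0"
    and N: "N \<ge> 1" and r: "r \<ge> 0"
  shows "\<bar>u r\<bar> \<le> \<bar>\<alpha>\<bar>"
proof (cases "r = 0")
  case True
  then show ?thesis using sol by (auto simp: is_radial_solution_def)
next
  case False
  with r have r: "r > 0" by simp
  obtain u' u'' where u: "\<And>r. r \<ge> 0 \<Longrightarrow> (u has_real_derivative u' r) (at r within {0..})"
    "\<And>r. r > 0 \<Longrightarrow> (u' has_real_derivative u'' r) (at r)"
    "\<And>r. r > 0 \<Longrightarrow> u'' r + (real N - 1) / r * u' r + g (u r) = 0" "u 0 = \<alpha>" "u' 0 = 0"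
    using sol unfolding is_radial_solution_def by blast
  have "isCont g x" for x using g(1) by (simp add: continuous_on_eq_continuous_at)
  then obtain G where "\<And>x. (G has_vector_derivative g x) (at x)"
    using einterval_antiderivative[of "-\<infinity>" "\<infinity>" g] by auto
  then have G: "(G has_real_derivative g x) (at x)" for x
    by (simp add: has_real_derivative_iff_has_vector_derivative)
  have even: "G (- x) = G x" for x
  proof -
    have "((\<lambda>x. G (- x) - G x) has_real_derivative 0) (at x)" for x
      by (auto intro!: derivative_eq_intros DERIV_chain2[OF G] G simp: g(2))
    then have "G (- x) - G x = G (- 0) - G 0"
      using DERIV_isconst_all[of "\<lambda>x. G (- x) - G x" x 0] by auto
    then show ?thesis by simp
  qed
  then have Gabs: "G \<bar>x\<bar> = G x" for x by (simp add: abs_if)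
  have Gmono: "G x < G y" if "0 \<le> x" "x < y" for x y
  proof (rule DERIV_pos_imp_increasing_open[OF that(2)])
    fix z assume "x < z" "z < y"
    then show "\<exists>y. (G has_real_derivative y) (at z) \<and> 0 < y" using G g(3)[of z] that by force
  next
    show "continuous_on {x..y} G"
      using G by (intro continuous_at_imp_continuous_on) (blast intro: DERIV_isCont)
  qed
  define E where "E = (\<lambda>r. (u' r)\<^sup>2 / 2 + G (u r))"
  have uat: "(u has_real_derivative u' t) (at t)" if "t > 0" for t
    using u(1)[of t] that by (simp add: at_within_atLeast_0)
  have Ed: "(E has_real_derivative - (real N - 1) / t * (u' t)\<^sup>2) (at t)" if "t > 0" for t
  proof -
    have "(E has_real_derivative u' t * u'' t + g (u t) * u' t) (at t)"
      unfolding E_def using that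
      by (auto intro!: derivative_eq_intros uat u(2) DERIV_chain2[OF G])
    moreover have "u'' t = - ((real N - 1) / t * u' t) - g (u t)" using u(3)[OF that] by linarith
    then have "u' t * u'' t + g (u t) * u' t = - (real N - 1) / t * (u' t)\<^sup>2"
      using that by (simp only:) (simp add: field_simps power2_eq_square)
    ultimately show ?thesis by simp
  qed
  have Emono: "E r \<le> E s" if "0 < s" "s \<le> r" for s
  proof (rule DERIV_nonpos_imp_nonincreasing[OF that(2)])
    fix t assume "s \<le> t" "t \<le> r"
    then have "t > 0" using that by simp
    moreover then have "- (real N - 1) / t * (u' t)\<^sup>2 \<le> 0"
      using N by (intro mult_nonpos_nonneg divide_nonpos_pos) auto
    ultimately show "\<exists>y. (E has_real_derivative y) (at t) \<and> y \<le> 0" using Ed by blast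
  qed
  \<comment> \<open>Monotonicity of E is known only for r > 0, so the value at 0 is reached as a
    limit along \<xi>.\<close>
  obtain \<xi> where \<xi>: "\<And>n. 0 < \<xi> n" "\<xi> \<longlonglongrightarrow> 0" "(\<lambda>n. u' (\<xi> n)) \<longlonglongrightarrow> u' 0"
    using radial_derivative_sequence[of u u'] u(1) by blast
  have "continuous_on {0..} u" using u(1) by (intro DERIV_continuous_on) auto
  then have "(u \<longlongrightarrow> u 0) (at 0 within {0..})" by (auto simp: continuous_on_def)
  moreover have "filterlim \<xi> (at 0 within {0..}) sequentially"
    using \<xi> by (auto simp: filterlim_at less_imp_le less_imp_neq[symmetric] intro!: always_eventually)
  ultimately have "(\<lambda>n. u (\<xi> n)) \<longlonglongrightarrow> \<alpha>"
    using filterlim_compose[of u "nhds \<alpha>" "at 0 within {0..}" \<xi>] u(4) by simp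
  then have "(\<lambda>n. E (\<xi> n)) \<longlonglongrightarrow> (u' 0)\<^sup>2 / 2 + G \<alpha>"
    unfolding E_def using G by (intro tendsto_intros \<xi>(3) isCont_tendsto_compose[of \<alpha> G]) (auto intro: DERIV_isCont)
  moreover have "\<forall>\<^sub>F n in sequentially. E r \<le> E (\<xi> n)"
    using order_tendstoD(2)[OF \<xi>(2) r] by eventually_elim (intro Emono \<xi>(1), simp)
  ultimately have "E r \<le> (u' 0)\<^sup>2 / 2 + G \<alpha>"
    by (intro tendsto_lowerbound[of "\<lambda>n. E (\<xi> n)"]) auto
  then have "G \<bar>u r\<bar> \<le> G \<bar>\<alpha>\<bar>" using u(5) unfolding Gabs E_def
    by (smt (verit, best) zero_le_power2 divide_nonneg_nonneg zero_eq_power2 div_0)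
  then show ?thesis using Gmono[of "\<bar>\<alpha>\<bar>" "\<bar>u r\<bar>"] by linarith
qed

text \<open>Trades the singular second-order problem for a first-order integro-differential one.
  Forward, r^(N-1) u' plus the integral of t^(N-1) f(u) is constant on r > 0 and tends to 0 along
  the sequence \<xi>, hence vanishes; backward, \<open>radial_avg_deriv\<close> recovers the
  equation.\<close>

lemma is_radial_solution_iff:
  assumes f: "continuous_on UNIV f" and N: "N \<ge> 1"
  shows "is_radial_solution N f \<alpha> u \<longleftrightarrow> u 0 = \<alpha> \<and>
     (\<forall>r\<ge>0. (u has_real_derivative - radial_avg N (\<lambda>t. f (u t)) r) (at r within {0..}))"
    (is "?L \<longleftrightarrow> ?R")
proof
  assume ?L
  then obtain u' u'' where u: "\<And>r. r \<ge> 0 \<Longrightarrow> (u has_real_derivative u' r) (at r within {0..})"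
    "\<And>r. r > 0 \<Longrightarrow> (u' has_real_derivative u'' r) (at r)"
    "\<And>r. r > 0 \<Longrightarrow> u'' r + (real N - 1) / r * u' r + f (u r) = 0" "u 0 = \<alpha>" "u' 0 = 0"
    unfolding is_radial_solution_def by blast
  have cu: "continuous_on {0..} u" using u(1) by (intro DERIV_continuous_on) auto
  have cfu: "continuous_on {0..} (\<lambda>t. f (u t))"
    by (rule continuous_on_compose2[OF f cu]) auto
  define P where "P = (\<lambda>r. integral {0..r} (\<lambda>t. t ^ (N - 1) * f (u t)))"
  have cP: "continuous_on {0..} P" unfolding P_def
    by (intro continuous_on_integral_atLeast continuous_on_weighted cfu)
  define p where "p = (\<lambda>r. r ^ (N - 1) * u' r + P r)"
  have pd: "(p has_real_derivative 0) (at r)" if "r > 0" for r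
  proof -
    have "(P has_real_derivative r ^ (N - 1) * f (u r)) (at r)"
      unfolding P_def by (rule integral_has_real_derivative_at[OF continuous_on_weighted[OF cfu] that])
    then have "(p has_real_derivative real (N - 1) * r ^ (N - 1 - 1) * u' r + r ^ (N - 1) * u'' r + r ^ (N - 1) * f (u r)) (at r)"
      unfolding p_def using u(2)[OF that]
      by (auto intro!: derivative_eq_intros)
    moreover have "real (N - 1) * r ^ (N - 1 - 1) = r ^ (N - 1) * ((real N - 1) / r)"
    proof (cases "N = 1")
      case False
      then have "N - 1 = Suc (N - 1 - 1)" using N by arith
      then have "r ^ (N - 1) = r * r ^ (N - 1 - 1)" by (metis power_Suc)
      then show ?thesis using that N by (simp add: of_nat_diff)
    qed simp
    then have "real (N - 1) * r ^ (N - 1 - 1) * u' r + r ^ (N - 1) * u'' r + r ^ (N - 1) * f (u r)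
      = r ^ (N - 1) * (u'' r + (real N - 1) / r * u' r + f (u r))"
      by (simp only:) (simp add: algebra_simps)
    ultimately show ?thesis using u(3)[OF that] by simp
  qed
  obtain \<xi> where \<xi>: "\<And>n. 0 < \<xi> n" "\<xi> \<longlonglongrightarrow> 0" "(\<lambda>n. u' (\<xi> n)) \<longlonglongrightarrow> u' 0"
    using radial_derivative_sequence[of u u'] u(1) by blast
  have p0: "p r = 0" if "r > 0" for r
  proof -
    have "p (\<xi> n) = p r" for n
    proof -
      obtain c where "\<And>x. x \<in> {0<..} \<Longrightarrow> p x = c"
        using has_field_derivative_zero_constant[of "{0<..}" p] pd
        by (metis convex_real_interval(3) greaterThan_iff has_field_derivative_at_within)
      then show ?thesis using that \<xi>(1) by auto
    qed
    moreover have "(\<lambda>n. p (\<xi> n)) \<longlonglongrightarrow> 0"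
    proof -
      have "(P \<longlongrightarrow> P 0) (at 0 within {0..})" using cP by (auto simp: continuous_on_def)
      moreover have "filterlim \<xi> (at 0 within {0..}) sequentially"
        using \<xi> by (auto simp: filterlim_at less_imp_le less_imp_neq[symmetric] intro!: always_eventually)
      ultimately have "(\<lambda>n. P (\<xi> n)) \<longlonglongrightarrow> P 0" by (rule filterlim_compose)
      then have "(\<lambda>n. p (\<xi> n)) \<longlonglongrightarrow> 0 ^ (N - 1) * u' 0 + P 0"
        unfolding p_def by (intro tendsto_intros \<xi>)
      then show ?thesis using u(5) by (simp add: P_def)
    qed
    ultimately show ?thesis by (simp add: LIMSEQ_const_iff)
  qed
  have "u' r = - radial_avg N (\<lambda>t. f (u t)) r" if "r \<ge> 0" for r
  proof (cases "r = 0")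
    case False
    then show ?thesis using p0[of r] that unfolding p_def P_def radial_avg_def
      by (simp add: field_simps add_eq_0_iff)
  qed (simp add: u)
  then show ?R using u(1,4) by auto
next
  assume R: ?R
  have cu: "continuous_on {0..} u" using R by (intro DERIV_continuous_on) auto
  have cfu: "continuous_on {0..} (\<lambda>t. f (u t))"
    by (rule continuous_on_compose2[OF f cu]) auto
  let ?V = "radial_avg N (\<lambda>t. f (u t))"
  show ?L unfolding is_radial_solution_def
  proof (rule exI[of _ "\<lambda>r. - ?V r"], rule exI[of _ "\<lambda>r. - (f (u r) - (real N - 1) / r * ?V r)"],
      intro conjI allI impI)
    fix r :: real assume "r > 0"
    then show "((\<lambda>r. - ?V r) has_real_derivative - (f (u r) - (real N - 1) / r * ?V r)) (at r)"
      by (intro derivative_intros radial_avg_deriv cfu N)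
  qed (use R in auto)
qed

lemma radial_integral_equation:
  assumes "\<And>r. r \<ge> 0 \<Longrightarrow> (u has_real_derivative - radial_avg N g r) (at r within {0..})"
    "0 \<le> r"
  shows "(radial_avg N g has_integral u 0 - u r) {0..r}"
proof -
  have "((\<lambda>t. - radial_avg N g t) has_integral u r - u 0) {0..r}"
    using assms(2)
    by (intro fundamental_theorem_of_calculus)
      (auto simp: has_real_derivative_iff_has_vector_derivative[symmetric] intro!: DERIV_subset[OF assms(1)])
  from has_integral_neg[OF this] show ?thesis by simp
qed

text \<open>In place of Gronwall's inequality: at a maximum point s of d(t) = |u - v| exp(-l t) the
  integral equation gives d(s) <= |u(0) - v(0)| + d(s)/2, and the last term is absorbed.\<close>

lemma radial_dependence:
  assumes u: "\<And>r. r \<ge> 0 \<Longrightarrow> (u has_real_derivative - radial_avg N (\<lambda>t. f (u t)) r) (at r within {0..})"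
    and v: "\<And>r. r \<ge> 0 \<Longrightarrow> (v has_real_derivative - radial_avg N (\<lambda>t. f (v t)) r) (at r within {0..})"
    and f: "continuous_on UNIV f" and N: "N \<ge> 1"
    and L: "L \<ge> 0" "\<And>t. 0 \<le> t \<Longrightarrow> \<bar>f (u t) - f (v t)\<bar> \<le> L * \<bar>u t - v t\<bar>" and r: "0 \<le> r"
  shows "\<bar>u r - v r\<bar> \<le> 2 * \<bar>u 0 - v 0\<bar> * exp ((L + 1) * r)"
proof -
  define l where "l = L + 1"
  have l: "l > 0" "L \<le> l\<^sup>2 / 2" using L(1) by (auto simp: l_def power2_eq_square algebra_simps)
  have cu: "continuous_on {0..} u" "continuous_on {0..} v"
    using u v by (auto intro!: DERIV_continuous_on)
  have cf: "continuous_on {0..} (\<lambda>t. f (u t))" "continuous_on {0..} (\<lambda>t. f (v t))"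
    by (auto intro!: continuous_on_compose2[OF f] cu)
  define d where "d = (\<lambda>t. \<bar>u t - v t\<bar> * exp (- l * t))"
  have "continuous_on {0..r} d" unfolding d_def
    by (intro continuous_intros continuous_on_subset[OF cu(1)] continuous_on_subset[OF cu(2)]) auto
  then obtain s where s: "s \<in> {0..r}" "\<And>t. t \<in> {0..r} \<Longrightarrow> d t \<le> d s"
    using continuous_attains_sup[of "{0..r}" d] r by auto
  have dt: "\<bar>u t - v t\<bar> = d t * exp (l * t)" for t
    by (simp add: d_def exp_minus)
  have "\<bar>integral {0..s} (radial_avg N (\<lambda>t. f (u t) - f (v t)))\<bar> \<le> L * d s * exp (l * s) / l\<^sup>2"
  proof (rule integral_radial_avg_exp_bound)
    fix t assume t: "0 \<le> t" "t \<le> s"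
    have "\<bar>f (u t) - f (v t)\<bar> \<le> L * (d t * exp (l * t))" using L(2)[of t] t by (simp add: dt)
    also have "\<dots> \<le> L * (d s * exp (l * t))"
      using s t L(1) by (intro mult_left_mono mult_right_mono) auto
    finally show "\<bar>f (u t) - f (v t)\<bar> \<le> L * d s * exp (l * t)" by (simp add: algebra_simps)
  qed (use s l N cf in \<open>auto intro!: continuous_intros\<close>)
  moreover have "integral {0..s} (radial_avg N (\<lambda>t. f (u t) - f (v t))) = (u 0 - u s) - (v 0 - v s)"
    using has_integral_diff[OF radial_integral_equation[OF u, of s] radial_integral_equation[OF v, of s]] s
    by (simp add: radial_avg_diff[OF cf] integral_unique cong: integral_cong)
  ultimately have "\<bar>u s - v s\<bar> \<le> \<bar>u 0 - v 0\<bar> + L * d s * exp (l * s) / l\<^sup>2" by linarith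
  then have "\<bar>u s - v s\<bar> * exp (- l * s) \<le> (\<bar>u 0 - v 0\<bar> + L * d s * exp (l * s) / l\<^sup>2) * exp (- l * s)"
    by (intro mult_right_mono) auto
  also have "\<dots> = \<bar>u 0 - v 0\<bar> * exp (- l * s) + L / l\<^sup>2 * d s"
    by (simp add: algebra_simps exp_minus)
  also have "\<dots> \<le> \<bar>u 0 - v 0\<bar> * 1 + 1/2 * d s"
    using s l by (intro add_mono mult_left_mono mult_right_mono) (auto simp: d_def field_simps)
  finally have "d s \<le> 2 * \<bar>u 0 - v 0\<bar>" by (simp add: d_def)
  then have "d r \<le> 2 * \<bar>u 0 - v 0\<bar>" using s(2)[of r] r by simp
  then show ?thesis unfolding dt l_def[symmetric] by (intro mult_right_mono) auto
qed

section \<open>The nonlinearity and the family of its radial solutions\<close>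

locale radial_problem =
  fixes N :: nat and f :: "real \<Rightarrow> real"
  assumes N: "N \<ge> 11" and standing: "standing_assumptions f"
begin

lemma f_deriv: "(f has_real_derivative deriv f x) (at x)"
  using standing by (auto simp: standing_assumptions_def C1_fun_def DERIV_deriv_iff_real_differentiable)

lemma continuous_f: "continuous_on A f"
  using f_deriv by (intro DERIV_continuous_on) (rule has_field_derivative_at_within)

lemma continuous_deriv_f: "continuous_on A (deriv f)"
  using standing by (auto simp: standing_assumptions_def C1_fun_def intro: continuous_on_subset)

lemma f_odd: "f (- x) = - f x"
  using standing by (simp add: standing_assumptions_def)

lemma f_0: "f 0 = 0" using f_odd[of 0] by simp

lemma f_pos: "x > 0 \<Longrightarrow> f x > 0" and deriv_f_pos: "x > 0 \<Longrightarrow> deriv f x > 0"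
  using standing by (auto simp: standing_assumptions_def)

lemma deriv_f_even: "deriv f (- x) = deriv f x"
proof -
  have "((\<lambda>x. f (- x)) has_real_derivative - deriv f (- x)) (at x)"
    using f_deriv[of "- x"] by (simp add: DERIV_mirror)
  moreover have "((\<lambda>x. f (- x)) has_real_derivative - deriv f x) (at x)"
    unfolding f_odd by (intro derivative_intros f_deriv)
  ultimately show ?thesis using DERIV_unique by force
qed

lemma deriv_f_strict_mono:
  assumes "0 \<le> x" "x < y"
  shows "deriv f x < deriv f y"
proof (rule DERIV_pos_imp_increasing_open[OF assms(2)])
  fix z assume "x < z" "z < y"
  then have "z > 0" using assms by simp
  then have "(deriv f has_real_derivative deriv (deriv f) z) (at z)" "deriv (deriv f) z > 0"
    using standing by (auto simp: standing_assumptions_def C2_off_zero_def DERIV_deriv_iff_real_differentiable)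
  then show "\<exists>y. (deriv f has_real_derivative y) (at z) \<and> 0 < y" by blast
qed (rule continuous_deriv_f)

lemma deriv_f_mono: "\<bar>x\<bar> \<le> y \<Longrightarrow> deriv f x \<le> deriv f y"
  using deriv_f_strict_mono[of "\<bar>x\<bar>" y] deriv_f_even[of x] by (cases "\<bar>x\<bar> = y") (auto simp: abs_if split: if_splits)

lemma deriv_f_nonneg: "deriv f x \<ge> 0"
proof -
  have "deriv f 0 \<le> deriv f x" using deriv_f_mono[of 0 "\<bar>x\<bar>"] deriv_f_even[of x] by (cases "x < 0") auto
  moreover have "deriv f 0 \<ge> 0"
  proof (rule tendsto_lowerbound)
    show "(deriv f \<longlongrightarrow> deriv f 0) (at_right 0)"
      using continuous_deriv_f[of UNIV] by (auto simp: continuous_on_def intro: tendsto_within_subset)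
    show "\<forall>\<^sub>F x in at_right 0. 0 \<le> deriv f x"
      unfolding eventually_at_right_field using deriv_f_pos by (intro exI[of _ 1]) (auto simp: less_imp_le)
  qed simp
  ultimately show ?thesis by simp
qed

lemma f_mean_value:
  assumes "x < y"
  obtains z where "x < z" "z < y" "f y - f x = deriv f z * (y - x)"
  using MVT2[OF assms, of f "deriv f"] f_deriv by (auto simp: mult.commute)

lemma f_strict_mono: "0 \<le> x \<Longrightarrow> x < y \<Longrightarrow> f x < f y"
  using f_mean_value[of x y] deriv_f_pos by (smt (verit) mult_pos_pos)

lemma f_mono: "0 \<le> x \<Longrightarrow> x \<le> y \<Longrightarrow> f x \<le> f y"
  using f_strict_mono[of x y] by (cases "x = y") auto

text \<open>Strict convexity on the positive axis. This is the source of every strict inequality g <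
  f'(U \<alpha>) w in the comparison argument.\<close>

lemma f_diff_less:
  assumes "0 \<le> x" "x < y"
  shows "f y - f x < deriv f y * (y - x)"
proof -
  obtain z where z: "x < z" "z < y" "f y - f x = deriv f z * (y - x)"
    using f_mean_value[OF assms(2)] by blast
  then show ?thesis using deriv_f_strict_mono[of z y] assms by (auto intro: mult_strict_right_mono)
qed

lemma f_Lipschitz:
  assumes "\<bar>x\<bar> \<le> A" "\<bar>y\<bar> \<le> A"
  shows "\<bar>f x - f y\<bar> \<le> deriv f A * \<bar>x - y\<bar>"
proof -
  have *: "\<bar>f x - f y\<bar> \<le> deriv f A * \<bar>x - y\<bar>" if xy: "y < x" "\<bar>x\<bar> \<le> A" "\<bar>y\<bar> \<le> A" for x y
  proof -
    obtain z where z: "y < z" "z < x" "f x - f y = deriv f z * (x - y)"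
      using f_mean_value[OF xy(1)] by blast
    have "deriv f z \<le> deriv f A" using z that by (intro deriv_f_mono) auto
    then show ?thesis using z(3) that(1) deriv_f_nonneg[of z] by (auto simp: abs_mult intro: mult_right_mono)
  qed
  show ?thesis using *[of x y] *[of y x] assms
    by (cases x y rule: linorder_cases) (auto simp: abs_minus_commute)
qed

lemma N_ge_1: "N \<ge> 1" using N by simp

lemmas radial_iff = is_radial_solution_iff[OF continuous_f N_ge_1]

text \<open>Cutting the argument of f off at height \<alpha> makes the nonlinearity globally
  Lipschitz while keeping it odd and positive on the positive axis. The energy bound then shows that
  |u| <= \<alpha>, so the cutoff is never active.\<close>

lemma radial_solution_exists:
  assumes "\<alpha> > 0"
  obtains u where "is_radial_solution N f \<alpha> u"
proof -
  define c where "c = (\<lambda>x. max (- \<alpha>) (min \<alpha> x))"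
  have c: "\<bar>c x\<bar> \<le> \<alpha>" "\<bar>c x - c y\<bar> \<le> \<bar>x - y\<bar>" "c (- x) = - c x" "x > 0 \<Longrightarrow> c x > 0" for x y
    using assms by (auto simp: c_def max_def min_def)
  have lip: "\<bar>f (c x) - f (c y)\<bar> \<le> deriv f \<alpha> * \<bar>x - y\<bar>" for x y
    using f_Lipschitz[OF c(1) c(1), of x y] mult_left_mono[OF c(2)[of x y] deriv_f_nonneg[of \<alpha>]] by linarith
  have cont: "continuous_on UNIV (\<lambda>x. f (c x))"
    unfolding c_def by (intro continuous_on_compose2[OF continuous_f[of UNIV]] continuous_intros) auto
  obtain u where u: "continuous_on {0..} u"
    "\<And>r. 0 \<le> r \<Longrightarrow> u r = \<alpha> - integral {0..r} (radial_avg N (\<lambda>t. f (c (u t))))"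
  proof (rule volterra_existence[where \<phi>="\<lambda>x. f (c x)" and \<alpha>=\<alpha>, OF lip N_ge_1])
    fix u assume "continuous_on {0..} u"
      "\<And>r. 0 \<le> r \<Longrightarrow> u r = \<alpha> - integral {0..r} (radial_avg N (\<lambda>t. f (c (u t))))"
    then show thesis by (rule that)
  qed
  have cfu: "continuous_on {0..} (\<lambda>t. f (c (u t)))"
    by (rule continuous_on_compose2[OF cont u(1)]) auto
  have der: "(u has_real_derivative - radial_avg N (\<lambda>t. f (c (u t))) r) (at r within {0..})" if "r \<ge> 0" for r
  proof -
    have "((\<lambda>r. \<alpha> - integral {0..r} (radial_avg N (\<lambda>t. f (c (u t))))) has_real_derivative
      0 - radial_avg N (\<lambda>t. f (c (u t))) r) (at r within {0..})"
      by (rule DERIV_diff[OF DERIV_const integral_has_real_derivative_atLeast[OF continuous_on_radial_avg[OF cfu N_ge_1] that]])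
    moreover have "x \<in> {0..} \<Longrightarrow> u x = \<alpha> - integral {0..x} (radial_avg N (\<lambda>t. f (c (u t))))" for x
      by (rule u(2)) (simp only: atLeast_iff)
    moreover have "r \<in> {0..}" using that by simp
    ultimately have "(u has_real_derivative 0 - radial_avg N (\<lambda>t. f (c (u t))) r) (at r within {0..})"
      unfolding has_field_derivative_def by (metis (no_types, lifting) has_derivative_transform)
    then show ?thesis by simp
  qed
  have u0: "u 0 = \<alpha>" using u(2)[of 0] by simp
  then have sol: "is_radial_solution N (\<lambda>x. f (c x)) \<alpha> u"
    unfolding is_radial_solution_iff[OF cont N_ge_1] using u0 der by auto
  have le: "\<bar>u r\<bar> \<le> \<alpha>" if "r \<ge> 0" for r
    using radial_solution_bound[OF sol cont _ _ N_ge_1 that] c f_odd f_pos assms by simp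
  have "c (u r) = u r" if "r \<ge> 0" for r using le[OF that] by (auto simp: c_def)
  then have "radial_avg N (\<lambda>t. f (c (u t))) r = radial_avg N (\<lambda>t. f (u t)) r" for r
    by (intro radial_avg_cong) auto
  then have "is_radial_solution N f \<alpha> u" unfolding radial_iff using der u0 by auto
  then show ?thesis using that by blast
qed

lemma radial_solution_abs_le:
  "is_radial_solution N f \<alpha> u \<Longrightarrow> \<alpha> > 0 \<Longrightarrow> r \<ge> 0 \<Longrightarrow> \<bar>u r\<bar> \<le> \<alpha>"
  using radial_solution_bound[OF _ continuous_f f_odd f_pos N_ge_1, of \<alpha> u r] by simp

text \<open>Both solutions stay in [-A, A], where f has Lipschitz constant f'(A). Equal initial
  values give uniqueness, converging ones give \<open>U_tendsto\<close>.\<close>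

lemma radial_solution_dependence:
  assumes "is_radial_solution N f \<alpha> u" "is_radial_solution N f \<beta> v"
    "0 < \<alpha>" "\<alpha> \<le> A" "0 < \<beta>" "\<beta> \<le> A" "r \<ge> 0"
  shows "\<bar>u r - v r\<bar> \<le> 2 * \<bar>\<alpha> - \<beta>\<bar> * exp ((deriv f A + 1) * r)"
proof -
  have "\<bar>u r - v r\<bar> \<le> 2 * \<bar>u 0 - v 0\<bar> * exp ((deriv f A + 1) * r)"
  proof (rule radial_dependence[OF _ _ continuous_f N_ge_1 deriv_f_nonneg])
    show "\<bar>f (u t) - f (v t)\<bar> \<le> deriv f A * \<bar>u t - v t\<bar>" if "0 \<le> t" for t
      using radial_solution_abs_le[OF assms(1), of t] radial_solution_abs_le[OF assms(2), of t] assms that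
      by (intro f_Lipschitz) auto
  qed (use assms in \<open>auto simp: radial_iff\<close>)
  then show ?thesis using assms by (simp add: radial_iff)
qed

abbreviation U :: "real \<Rightarrow> real \<Rightarrow> real" where "U \<equiv> radial_sol N f"

text \<open>\<open>V \<alpha>\<close> is minus the radial derivative of \<open>U \<alpha>\<close>,
  as recorded in \<open>U_deriv\<close>.\<close>

abbreviation V :: "real \<Rightarrow> real \<Rightarrow> real" where "V \<alpha> \<equiv> radial_avg N (\<lambda>t. f (U \<alpha> t))"

text \<open>Justifies the definite description: uniqueness on r >= 0 comes from
  \<open>radial_solution_dependence\<close> with equal initial values, on r < 0 from the
  normalisation.\<close>

lemma radial_sol:
  assumes "\<alpha> > 0"
  shows "is_radial_solution N f \<alpha> (U \<alpha>)"
proof -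
  obtain u where u: "is_radial_solution N f \<alpha> u" by (rule radial_solution_exists[OF assms])
  \<comment> \<open>Setting the values at r < 0 to 0 affects neither derivatives within {0..} nor
    integrals from 0.\<close>
  define v where "v = (\<lambda>r. if r < 0 then 0 else u r)"
  have "radial_avg N (\<lambda>t. f (v t)) r = radial_avg N (\<lambda>t. f (u t)) r" for r
    by (intro radial_avg_cong) (auto simp: v_def)
  moreover have "(v has_real_derivative d) (at r within {0..})"
    if "(u has_real_derivative d) (at r within {0..})" "r \<ge> 0" for r d
  proof -
    have "r \<in> {0..}" "\<And>x. x \<in> {0..} \<Longrightarrow> v x = u x" using that(2) by (auto simp: v_def)
    from has_derivative_transform[OF this that(1)[unfolded has_field_derivative_def]] show ?thesis
      unfolding has_field_derivative_def .
  qed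
  ultimately have v: "is_radial_solution N f \<alpha> v" using u unfolding radial_iff by (auto simp: v_def)
  have "is_radial_solution N f \<alpha> (U \<alpha>) \<and> (\<forall>r<0. U \<alpha> r = 0)"
    unfolding radial_sol_def
  proof (rule theI[of _ v])
    show "is_radial_solution N f \<alpha> v \<and> (\<forall>r<0. v r = 0)" using v by (simp add: v_def)
    fix w assume w: "is_radial_solution N f \<alpha> w \<and> (\<forall>r<0. w r = 0)"
    have "w r = v r" for r
    proof (cases "r < 0")
      case False
      then show ?thesis
        using radial_solution_dependence[OF conjunct1[OF w] v assms order_refl assms order_refl, of r] by simp
    qed (use w in \<open>simp add: v_def\<close>)
    then show "w = v" by blast
  qed
  then show ?thesis ..
qed

lemma U_0: "\<alpha> > 0 \<Longrightarrow> U \<alpha> 0 = \<alpha>"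
  using radial_sol by (auto simp: radial_iff)

lemma U_deriv: "\<alpha> > 0 \<Longrightarrow> r \<ge> 0 \<Longrightarrow> (U \<alpha> has_real_derivative - V \<alpha> r) (at r within {0..})"
  using radial_sol by (auto simp: radial_iff)

lemma continuous_U: "\<alpha> > 0 \<Longrightarrow> continuous_on {0..} (U \<alpha>)"
  using U_deriv by (intro DERIV_continuous_on) auto

lemma continuous_fU: "\<alpha> > 0 \<Longrightarrow> continuous_on {0..} (\<lambda>r. f (U \<alpha> r))"
  by (intro continuous_on_compose2[OF continuous_f[of UNIV] continuous_U]) auto

lemma continuous_dfU: "\<alpha> > 0 \<Longrightarrow> continuous_on {0..} (\<lambda>r. deriv f (U \<alpha> r))"
  by (intro continuous_on_compose2[OF continuous_deriv_f[of UNIV] continuous_U]) auto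

lemma continuous_V: "\<alpha> > 0 \<Longrightarrow> continuous_on {0..} (V \<alpha>)"
  by (intro continuous_on_radial_avg continuous_fU N_ge_1)

lemma U_abs_le: "\<alpha> > 0 \<Longrightarrow> r \<ge> 0 \<Longrightarrow> \<bar>U \<alpha> r\<bar> \<le> \<alpha>"
  using radial_solution_abs_le[OF radial_sol] .

lemma U_tendsto:
  assumes "a \<longlonglongrightarrow> \<alpha>" "\<And>n. a n > 0" "\<alpha> > 0" "r \<ge> 0"
  shows "(\<lambda>n. U (a n) r) \<longlonglongrightarrow> U \<alpha> r"
proof -
  have "Bseq a" using assms(1) by (intro convergent_imp_Bseq) (auto simp: convergent_def)
  then obtain K where K: "\<And>n. \<bar>a n\<bar> \<le> K" by (auto simp: Bseq_def)
  define A where "A = max K \<alpha>"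
  have A: "\<alpha> \<le> A" "a n \<le> A" for n using K[of n] by (auto simp: A_def)
  have "(\<lambda>n. 2 * \<bar>a n - \<alpha>\<bar> * exp ((deriv f A + 1) * r)) \<longlonglongrightarrow> 2 * \<bar>\<alpha> - \<alpha>\<bar> * exp ((deriv f A + 1) * r)"
    by (intro tendsto_intros assms(1))
  then have "(\<lambda>n. 2 * \<bar>a n - \<alpha>\<bar> * exp ((deriv f A + 1) * r)) \<longlonglongrightarrow> 0" by simp
  moreover have "\<forall>\<^sub>F n in sequentially. norm (U (a n) r - U \<alpha> r) \<le> 2 * \<bar>a n - \<alpha>\<bar> * exp ((deriv f A + 1) * r)"
    using radial_solution_dependence[OF radial_sol radial_sol, OF assms(2,3,2) A(2) assms(3) A(1) assms(4)]
    by (intro always_eventually) simp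
  ultimately have "(\<lambda>n. U (a n) r - U \<alpha> r) \<longlonglongrightarrow> 0"
    by (rule Lim_null_comparison[rotated])
  then show ?thesis by (simp add: LIM_zero_iff)
qed

end

section \<open>Radial integrals and radial test functions\<close>

text \<open>The sign makes all upper tails \<open>{x<..}\<close> of the image measure finite.\<close>

lemma distr_minus_norm:
  fixes c :: real
  defines "n \<equiv> DIM('a::euclidean_space)"
  defines "c \<equiv> real n * unit_ball_vol (real n)"
  shows "distr (lborel :: 'a measure) borel (\<lambda>x. - norm x)
    = density lborel (\<lambda>r. ennreal (indicator {..0} r * (c * (- r) ^ (n - 1))))"
proof (rule measure_eqI_lessThan)
  have n: "n > 0" by (simp add: n_def)
  have M: "emeasure (distr (lborel :: 'a measure) borel (\<lambda>x. - norm x)) {x<..}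
     = (if x < 0 then ennreal (unit_ball_vol (real n) * (- x) ^ n) else 0)" for x
  proof -
    have "emeasure (distr (lborel :: 'a measure) borel (\<lambda>x. - norm x)) {x<..} = emeasure (lborel :: 'a measure) (ball 0 (- x))"
      by (subst emeasure_distr) (auto intro!: arg_cong[where f="emeasure lborel"])
    then show ?thesis by (cases "x < 0") (simp_all add: emeasure_ball n_def ball_empty)
  qed
  then show "emeasure (distr (lborel :: 'a measure) borel (\<lambda>x. - norm x)) {x<..} < \<infinity>" for x by simp
  show "emeasure (distr (lborel :: 'a measure) borel (\<lambda>x. - norm x)) {x<..}
     = emeasure (density lborel (\<lambda>r. ennreal (indicator {..0} r * (c * (- r) ^ (n - 1))))) {x<..}" for x
  proof (cases "x < 0")
    case False
    have "emeasure (density lborel (\<lambda>r. ennreal (indicator {..0} r * (c * (- r) ^ (n - 1))))) {x<..}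
      = (\<integral>\<^sup>+ r. ennreal (indicator {..0} r * (c * (- r) ^ (n - 1))) * indicator {x<..} r \<partial>lborel)"
      by (subst emeasure_density) auto
    also have "\<dots> = (\<integral>\<^sup>+ (r::real). 0 \<partial>lborel)"
      using False by (intro nn_integral_cong) (auto simp: indicator_def)
    finally have "emeasure (density lborel (\<lambda>r. ennreal (indicator {..0} r * (c * (- r) ^ (n - 1))))) {x<..} = 0"
      by simp
    then show ?thesis using False by (simp add: M)
  next
    case True
    have "emeasure (density lborel (\<lambda>r. ennreal (indicator {..0} r * (c * (- r) ^ (n - 1))))) {x<..}
      = (\<integral>\<^sup>+ r. ennreal (indicator {..0} r * (c * (- r) ^ (n - 1))) * indicator {x<..} r \<partial>lborel)"
      by (subst emeasure_density) auto
    also have "\<dots> = (\<integral>\<^sup>+ r. ennreal (c * (- r) ^ (n - 1)) * indicator {x..0} r \<partial>lborel)"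
      using AE_lborel_singleton[of x] by (intro nn_integral_cong_AE) (auto elim!: eventually_mono simp: indicator_def)
    also have "\<dots> = ennreal ((- (unit_ball_vol (real n) * (- 0) ^ n)) - (- (unit_ball_vol (real n) * (- x) ^ n)))"
    proof (rule nn_integral_FTC_Icc[where F="\<lambda>r. - (unit_ball_vol (real n) * (- r) ^ n)"])
      show "((\<lambda>r. - (unit_ball_vol (real n) * (- r) ^ n)) has_real_derivative c * (- r) ^ (n - 1)) (at r)" for r
        by (auto intro!: derivative_eq_intros simp: c_def)
      show "0 \<le> c * (- r) ^ (n - 1)" if "r \<in> {x..0}" for r
        using that by (auto simp: c_def intro!: mult_nonneg_nonneg)
    qed (use True in auto)
    finally show ?thesis using True n by (simp add: M zero_power)
  qed
qed auto

text \<open>Integration in polar coordinates, read off from the image measure of -|x| and a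
  reflection of the half-line.\<close>

lemma integral_radial:
  fixes k :: "real \<Rightarrow> real" and R :: real
  defines "n \<equiv> DIM('a::euclidean_space)"
  assumes k: "continuous_on {0..} k" and R: "\<And>r. r \<ge> R \<Longrightarrow> k r = 0" "R \<ge> 0"
  shows "(LBINT x::'a. k (norm x)) = real n * unit_ball_vol (real n) * integral {0..R} (\<lambda>r. r ^ (n - 1) * k r)"
proof -
  define c where "c = real n * unit_ball_vol (real n)"
  have c: "c \<ge> 0" by (simp add: c_def)
  \<comment> \<open>The constant continuation to negative arguments is continuous on the whole line,
    hence Borel measurable.\<close>
  define k' where "k' = (\<lambda>r. k (max r 0))"
  have "continuous_on UNIV k'" unfolding k'_def
    by (intro continuous_on_compose2[OF k] continuous_intros) auto
  then have meas [measurable]: "k' \<in> borel_measurable borel" by (rule borel_measurable_continuous_onI)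
  have "(LBINT x::'a. k (norm x)) = (LBINT x::'a. k' (- (- norm x)))" by (simp add: k'_def)
  also have "\<dots> = integral\<^sup>L (distr (lborel :: 'a measure) borel (\<lambda>x. - norm x)) (\<lambda>y. k' (- y))"
    by (subst integral_distr) auto
  also have "\<dots> = (LBINT r. (indicator {..0} r * (c * (- r) ^ (n - 1))) *\<^sub>R k' (- r))"
    unfolding distr_minus_norm n_def[symmetric] c_def[symmetric]
    by (subst integral_density) (auto simp: indicator_def c intro!: mult_nonneg_nonneg)
  also have "\<dots> = (LBINT r. (indicator {..0} (- r) * (c * (- (- r)) ^ (n - 1))) *\<^sub>R k' (- (- r)))"
    by (subst lborel_integral_real_affine[where c="-1" and t=0]) auto
  also have "\<dots> = (LBINT r:{0..R}. c * (r ^ (n - 1) * k r))"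
    unfolding set_lebesgue_integral_def using R
    by (intro Bochner_Integration.integral_cong) (auto simp: indicator_def k'_def max_def)
  also have "\<dots> = integral {0..R} (\<lambda>r. c * (r ^ (n - 1) * k r))"
  proof (rule set_borel_integral_eq_integral(2))
    show "set_integrable lborel {0..R} (\<lambda>r. c * (r ^ (n - 1) * k r))"
      unfolding set_integrable_def
      by (intro borel_integrable_compact continuous_intros continuous_on_subset[OF k]) auto
  qed
  also have "\<dots> = c * integral {0..R} (\<lambda>r. r ^ (n - 1) * k r)" by simp
  finally show ?thesis by (simp add: c_def)
qed

section \<open>Radial test functions\<close>

text \<open>The condition \<open>h' 0 = 0\<close> is what makes h(|x|) continuously differentiable
  at the origin.\<close>

definition radial_test :: "(real \<Rightarrow> real) \<Rightarrow> (real \<Rightarrow> real) \<Rightarrow> real \<Rightarrow> bool" where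
  "radial_test h h' R \<longleftrightarrow> R \<ge> 0 \<and> (\<forall>r\<ge>0. (h has_real_derivative h' r) (at r within {0..})) \<and>
     continuous_on {0..} h' \<and> h' 0 = 0 \<and> (\<forall>r\<ge>R. h r = 0 \<and> h' r = 0)"

text \<open>Away from 0 this is the chain rule. At 0 the difference quotient of h and the length
  |h'(|x|)| of the gradient both tend to 0; division by zero gives the stated gradient the correct
  value 0 there.\<close>

lemma radial_test_C1_compact_support:
  assumes "radial_test h h' R"
  shows "C1_compact_support (\<lambda>x::real^'n. h (norm x)) (\<lambda>x. (h' (norm x) / norm x) *\<^sub>R x)"
  unfolding C1_compact_support_def
proof (intro conjI allI)
  have h: "\<And>r. r \<ge> 0 \<Longrightarrow> (h has_real_derivative h' r) (at r within {0..})"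
    and ch': "continuous_on {0..} h'" and h'0: "h' 0 = 0" and hR: "\<And>r. r \<ge> R \<Longrightarrow> h r = 0"
    using assms by (auto simp: radial_test_def)
  have nlim: "filterlim norm (at 0 within {0..}) (at (0::real^'n))"
    by (auto simp: filterlim_at tendsto_norm_zero_iff eventually_at_filter intro!: tendsto_eq_intros)
  show "GDERIV (\<lambda>x::real^'n. h (norm x)) x :> ((h' (norm x) / norm x) *\<^sub>R x)" for x
  proof (cases "x = 0")
    case False
    then have "(h has_real_derivative h' (norm x)) (at (norm x))"
      using h[of "norm x"] by (simp add: at_within_atLeast_0)
    from GDERIV_DERIV_compose[OF GDERIV_norm[OF False] this] show ?thesis
      by (simp add: sgn_div_norm divide_inverse)
  next
    case True
    have "((\<lambda>t. (h t - h 0) / (t - 0)) \<longlongrightarrow> 0) (at 0 within {0..})"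
      using h[of 0] h'0 by (simp add: has_field_derivative_iff)
    from filterlim_compose[OF this nlim]
    have "((\<lambda>y::real^'n. (h (norm y) - h 0) / norm y) \<longlongrightarrow> 0) (at 0)" by simp
    from tendsto_norm[OF this] have "((\<lambda>y::real^'n. norm (h (norm y) - h 0) / norm y) \<longlongrightarrow> 0) (at 0)" by simp
    then show ?thesis using True
      by (simp add: gderiv_def has_derivative_at)
  qed
  show "continuous_on UNIV (\<lambda>x::real^'n. (h' (norm x) / norm x) *\<^sub>R x)"
  proof (intro continuous_at_imp_continuous_on ballI)
    fix x :: "real^'n"
    show "isCont (\<lambda>x. (h' (norm x) / norm x) *\<^sub>R x) x"
    proof (cases "x = 0")
      case False
      have "continuous (at (norm x) within {0..}) h'" using ch' by (simp add: continuous_on_eq_continuous_within)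
      then have "isCont h' (norm x)" using False by (simp add: at_within_atLeast_0)
      then have "isCont (\<lambda>x. h' (norm x)) x" by (rule isCont_o2[rotated]) simp
      then show ?thesis using False by (intro continuous_intros) auto
    next
      case True
      have "(h' \<longlongrightarrow> 0) (at 0 within {0..})" using ch'[unfolded continuous_on_def, THEN bspec, of 0] h'0 by simp
      from filterlim_compose[OF this nlim] have "((\<lambda>y::real^'n. h' (norm y)) \<longlongrightarrow> 0) (at 0)" .
      then have "((\<lambda>y::real^'n. \<bar>h' (norm y)\<bar>) \<longlongrightarrow> 0) (at 0)" by (rule tendsto_rabs_zero)
      moreover have "\<forall>\<^sub>F y in at (0::real^'n). norm ((h' (norm y) / norm y) *\<^sub>R y) \<le> \<bar>h' (norm y)\<bar>"
        by (auto simp: eventually_at_filter)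
      ultimately have "((\<lambda>y::real^'n. (h' (norm y) / norm y) *\<^sub>R y) \<longlongrightarrow> 0) (at 0)"
        by (rule Lim_null_comparison[rotated])
      then show ?thesis using True by (simp add: isCont_def)
    qed
  qed
  have "{x::real^'n. h (norm x) \<noteq> 0} \<subseteq> cball 0 R"
  proof
    fix x :: "real^'n" assume "x \<in> {x. h (norm x) \<noteq> 0}"
    then show "x \<in> cball 0 R" using hR[of "norm x"] by (cases "R \<le> norm x") auto
  qed
  then show "compact (closure {x::real^'n. h (norm x) \<noteq> 0})"
    using bounded_subset[OF bounded_cball] by simp
qed

text \<open>The gradient of h(|x|) has length |h'(|x|)|, and the positive constant from polar
  coordinates can be cancelled.\<close>

lemma stable_radial_test:
  fixes u :: "real \<Rightarrow> real"
  assumes st: "stable f (\<lambda>x::real^'n. u (norm x))" and cont: "continuous_on {0..} (\<lambda>r. deriv f (u r))"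
    and test: "radial_test h h' R"
  shows "integral {0..R} (\<lambda>r. r ^ (CARD('n) - 1) * ((h' r)\<^sup>2 - deriv f (u r) * (h r)\<^sup>2)) \<ge> 0"
proof -
  let ?k = "\<lambda>r. (h' r)\<^sup>2 - deriv f (u r) * (h r)\<^sup>2"
  have ch: "continuous_on {0..} h" using test by (intro DERIV_continuous_on[where D=h']) (auto simp: radial_test_def)
  have ck: "continuous_on {0..} ?k"
    using test by (intro continuous_intros cont ch) (auto simp: radial_test_def)
  have "0 \<le> (LBINT x::real^'n. (norm ((h' (norm x) / norm x) *\<^sub>R x))\<^sup>2 - deriv f (u (norm x)) * (h (norm x))\<^sup>2)"
    using st radial_test_C1_compact_support[OF test] unfolding stable_def by blast
  also have "\<dots> = (LBINT x::real^'n. ?k (norm x))"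
  proof (rule Bochner_Integration.integral_cong)
    fix x :: "real^'n"
    have "norm ((h' (norm x) / norm x) *\<^sub>R x) = \<bar>h' (norm x)\<bar>"
      using test by (cases "x = 0") (auto simp: radial_test_def)
    then show "(norm ((h' (norm x) / norm x) *\<^sub>R x))\<^sup>2 - deriv f (u (norm x)) * (h (norm x))\<^sup>2 = ?k (norm x)"
      by simp
  qed simp
  also have "\<dots> = real DIM(real^'n) * unit_ball_vol (real DIM(real^'n)) * integral {0..R} (\<lambda>r. r ^ (DIM(real^'n) - 1) * ?k r)"
    using test by (intro integral_radial ck) (auto simp: radial_test_def)
  finally have "0 \<le> real CARD('n) * unit_ball_vol (real CARD('n)) * integral {0..R} (\<lambda>r. r ^ (CARD('n) - 1) * ?k r)"
    by simp
  moreover have "real CARD('n) * unit_ball_vol (real CARD('n)) > 0"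
    by (intro mult_pos_pos unit_ball_vol_pos) auto
  ultimately show ?thesis by (simp only: zero_le_mult_iff) linarith
qed

section \<open>Comparison of stable solutions\<close>

text \<open>Since k and k' both vanish at R, the extension by 0 is still continuously
  differentiable.\<close>

lemma radial_test_truncation:
  fixes k k' :: "real \<Rightarrow> real"
  assumes R: "R > 0" and k: "\<And>r. 0 \<le> r \<Longrightarrow> r \<le> R \<Longrightarrow> (k has_real_derivative k' r) (at r within {0..R})"
    and ck': "continuous_on {0..R} k'" and z: "k' 0 = 0" "k R = 0" "k' R = 0"
  shows "radial_test (\<lambda>r. if r \<in> {0..R} then k r else 0) (\<lambda>r. if r \<in> {0..R} then k' r else 0) R"
  unfolding radial_test_def
proof (intro conjI allI impI)
  have un: "{0..} = {0..R} \<union> {R<..}" using R by auto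
  have cl: "closure {0..R} \<inter> closure {R<..} = {R}" using R by auto
  have un2: "{0..R} \<union> {R} = {0..R}" using R by auto
  show "((\<lambda>r. if r \<in> {0..R} then k r else 0) has_real_derivative (if r \<in> {0..R} then k' r else 0)) (at r within {0..})"
    if "r \<ge> 0" for r
    unfolding has_real_derivative_iff_has_vector_derivative
  proof (rule has_vector_derivative_If_within_closures[OF _ un])
    show "r \<in> {0..R} \<union> {R<..}" using that by auto
    show "(k has_vector_derivative k' r) (at r within {0..R} \<union> closure {0..R} \<inter> closure {R<..})"
      if "r \<in> {0..R} \<union> closure {0..R} \<inter> closure {R<..}"
      using that k unfolding cl un2 by (simp add: has_real_derivative_iff_has_vector_derivative)
    show "((\<lambda>_. 0) has_vector_derivative (\<lambda>_. 0) r) (at r within {R<..} \<union> closure {0..R} \<inter> closure {R<..})"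
      by simp
    show "k r = 0" "k' r = 0" if "r \<in> closure {0..R}" "r \<in> closure {R<..}"
      using that R z by auto
  qed
  have "continuous_on ({0..R} \<union> {R..}) (\<lambda>r. if r \<in> {0..R} then k' r else 0)"
    using z by (intro continuous_on_If ck' continuous_intros) auto
  moreover have "{0..R} \<union> {R..} = {0..}" using R by auto
  ultimately show "continuous_on {0..} (\<lambda>r. if r \<in> {0..R} then k' r else 0)" by simp
qed (use R z in auto)

lemma first_zero:
  fixes m :: "real \<Rightarrow> real"
  assumes m: "continuous_on {0..} m" "m 0 > 0" and r: "r \<ge> 0" "m r \<le> 0"
  obtains r1 where "r1 > 0" "m r1 = 0" "\<And>t. 0 \<le> t \<Longrightarrow> t < r1 \<Longrightarrow> m t > 0"
proof -
  define B where "B = {x \<in> {0..}. m x \<le> 0}"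
  have cl: "closed B" unfolding B_def
    by (rule continuous_on_closed_Collect_le[OF m(1)]) auto
  have B: "r \<in> B" "bdd_below B" using r by (auto simp: B_def intro: bdd_belowI[of _ 0])
  define r1 where "r1 = Inf B"
  have r1: "r1 \<in> B" unfolding r1_def using closed_contains_Inf[OF _ B(2) cl] B(1) by blast
  then have r1': "r1 \<ge> 0" "m r1 \<le> 0" by (auto simp: B_def)
  have "\<exists>x\<ge>0. x \<le> r1 \<and> m x = 0"
    using IVT2'[of m r1 0 0] r1' m continuous_on_subset[OF m(1), of "{0..r1}"] by auto
  then obtain x where x: "x \<ge> 0" "x \<le> r1" "m x = 0" by blast
  then have "x \<in> B" by (simp add: B_def)
  then have "r1 \<le> x" unfolding r1_def using B(2) by (rule cInf_lower)
  then have "m r1 = 0" using x by simp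
  show ?thesis
  proof
    show "r1 > 0" using r1' m(2) \<open>m r1 = 0\<close> by (cases "r1 = 0") auto
    fix t assume t: "0 \<le> t" "t < r1"
    show "m t > 0"
    proof (rule ccontr)
      assume "\<not> m t > 0"
      then have "t \<in> B" using t by (simp add: B_def)
      then have "r1 \<le> t" unfolding r1_def using B(2) by (rule cInf_lower)
      then show False using t by simp
    qed
  qed fact
qed

text \<open>Pointwise form of the identity for the quadratic form at \<open>h = w \<zeta>\<close> with \<open>\<zeta> = w / (w + \<delta>)\<close>:
  here \<open>w' = - W\<close>, \<open>p = r\<^sup>N\<^sup>-\<^sup>1\<close>, \<open>(p W)' = p g\<close>, and the first summand on the right is
  the derivative of \<open>- p W w \<zeta>\<^sup>2\<close>.\<close>

lemma comparison_test_identity: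
  fixes \<delta> w W g q p :: real
  assumes "\<delta> > 0" "w \<ge> 0"
  shows "p * ((- W * ((w\<^sup>2 + 2 * \<delta> * w) / (w + \<delta>)\<^sup>2))\<^sup>2 - q * (w\<^sup>2 / (w + \<delta>))\<^sup>2) =
     (- (p * g) * (w * (w / (w + \<delta>))\<^sup>2) + (- (p * W)) * (- W * (w / (w + \<delta>))\<^sup>2
        + w * (2 * (w / (w + \<delta>)) * (- W * \<delta> / (w + \<delta>)\<^sup>2))))
     + p * ((W * w * \<delta> / (w + \<delta>)\<^sup>2)\<^sup>2 - (q * w - g) * w * (w / (w + \<delta>))\<^sup>2)"
proof -
  define e where "e = w + \<delta>"
  have e: "e \<noteq> 0" and d: "\<delta> = e - w" using assms by (auto simp: e_def)
  show ?thesis unfolding e_def[symmetric] d using e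
    by (simp add: field_simps power2_eq_square) 
qed

context radial_problem begin

text \<open>Stability tested on radial functions only, stated as a one-dimensional condition in N.
  The comparison and instability arguments use nothing more.\<close>

definition radially_stable :: "real \<Rightarrow> bool" where
  "radially_stable \<alpha> \<longleftrightarrow> (\<forall>h h' R. radial_test h h' R \<longrightarrow>
     integral {0..R} (\<lambda>r. r ^ (N - 1) * ((h' r)\<^sup>2 - deriv f (U \<alpha> r) * (h r)\<^sup>2)) \<ge> 0)"

text \<open>Here - Laplacian w = g < f'(U \<alpha>) w and w(r0) = 0, so the quadratic form at w
  would be negative; but w extended by 0 may have a kink at r0. The test function w^2 / (w +
  \<delta>) has zero slope there, and its error disappears as \<delta> tends to 0.\<close>

lemma radially_stable_no_touching:
  assumes \<alpha>: "\<alpha> > 0" and st: "radially_stable \<alpha>" and r0: "r0 > 0"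
    and g: "continuous_on {0..} g"
    and w: "\<And>r. r \<ge> 0 \<Longrightarrow> (w has_real_derivative - radial_avg N g r) (at r within {0..})"
    and wpos: "\<And>r. 0 \<le> r \<Longrightarrow> r < r0 \<Longrightarrow> w r > 0" and wr0: "w r0 = 0"
    and less: "\<And>r. 0 < r \<Longrightarrow> r < r0 \<Longrightarrow> g r < deriv f (U \<alpha> r) * w r"
  shows False
proof -
  let ?W = "radial_avg N g" and ?q = "\<lambda>r. deriv f (U \<alpha> r)"
  define P where "P = (\<lambda>r. integral {0..r} (\<lambda>t. t ^ (N - 1) * g t))"
  have P: "(P has_real_derivative r ^ (N - 1) * g r) (at r within {0..r0})" if "r \<in> {0..r0}" for r
    unfolding P_def using that
    by (intro DERIV_subset[OF integral_has_real_derivative_atLeast[OF continuous_on_weighted[OF g]]]) auto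
  have PW: "P r = r ^ (N - 1) * ?W r" if "r \<ge> 0" for r
    using that by (cases "r = 0") (auto simp: P_def radial_avg_def)
  have wr: "(w has_real_derivative - ?W r) (at r within {0..r0})" if "r \<in> {0..r0}" for r
    using that by (intro DERIV_subset[OF w]) auto
  have w0: "w r \<ge> 0" if "r \<in> {0..r0}" for r
    using wpos[of r] wr0 that by (cases "r = r0") auto
  have cw: "continuous_on {0..r0} w" using wr by (rule DERIV_continuous_on)
  have cW: "continuous_on {0..r0} ?W"
    by (rule continuous_on_subset[OF continuous_on_radial_avg[OF g N_ge_1]]) auto
  have cg: "continuous_on {0..r0} g" by (rule continuous_on_subset[OF g]) auto
  have cq: "continuous_on {0..r0} ?q" by (rule continuous_on_subset[OF continuous_dfU[OF \<alpha>]]) auto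
  \<comment> \<open>The quadratic form at the regularised w is the integral of T - S, up to a total
    derivative: S is the gain from the strict inequality, T the error caused by \<delta>.\<close>
  define S where "S = (\<lambda>\<delta> r. r ^ (N - 1) * ((?q r * w r - g r) * w r * (w r / (w r + \<delta>))\<^sup>2))"
  define T where "T = (\<lambda>\<delta> r. r ^ (N - 1) * (?W r * w r * \<delta> / (w r + \<delta>)\<^sup>2)\<^sup>2)"
  have nz: "w r + \<delta> > 0" if "r \<in> {0..r0}" "\<delta> > 0" for r \<delta> using w0[of r] that by linarith
  have nz': "\<forall>r\<in>{0..r0}. w r + \<delta> \<noteq> 0" "\<forall>r\<in>{0..r0}. (w r + \<delta>)\<^sup>2 \<noteq> 0" if "\<delta> > 0" for \<delta>
    using nz[OF _ that] by force+
  have cS: "continuous_on {0..r0} (S \<delta>)" if "\<delta> > 0" for \<delta>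
    unfolding S_def using nz'[OF that] by (intro continuous_intros cq cw cg) auto
  have cT: "continuous_on {0..r0} (T \<delta>)" if "\<delta> > 0" for \<delta>
    unfolding T_def using nz'[OF that] by (intro continuous_intros cW cw) auto
  have ineq: "integral {0..r0} (S \<delta>) \<le> integral {0..r0} (T \<delta>)" if \<delta>: "\<delta> > 0" for \<delta>
  proof -
    define k where "k = (\<lambda>r. (w r)\<^sup>2 / (w r + \<delta>))"
    define k' where "k' = (\<lambda>r. - ?W r * (((w r)\<^sup>2 + 2 * \<delta> * w r) / (w r + \<delta>)\<^sup>2))"
    have "radial_test (\<lambda>r. if r \<in> {0..r0} then k r else 0) (\<lambda>r. if r \<in> {0..r0} then k' r else 0) r0"
    proof (rule radial_test_truncation[OF r0])
      fix r assume "0 \<le> r" "r \<le> r0"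
      then have r: "r \<in> {0..r0}" by simp
      have "(k has_real_derivative ((2 * w r * - ?W r) * (w r + \<delta>) - (w r)\<^sup>2 * (- ?W r)) / ((w r + \<delta>) * (w r + \<delta>))) (at r within {0..r0})"
        unfolding k_def using nz[OF r \<delta>]
        by (auto intro!: derivative_eq_intros wr[OF r])
      moreover have "((2 * w r * - ?W r) * (w r + \<delta>) - (w r)\<^sup>2 * (- ?W r)) / ((w r + \<delta>) * (w r + \<delta>)) = k' r"
        unfolding k'_def by (simp add: power2_eq_square algebra_simps diff_divide_distrib add_divide_distrib)
      ultimately show "(k has_real_derivative k' r) (at r within {0..r0})" by simp
    next
      show "continuous_on {0..r0} k'" unfolding k'_def
        using nz'[OF \<delta>] by (intro continuous_intros cW cw) auto
    qed (use wr0 in \<open>auto simp: k_def k'_def\<close>)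
    then have "0 \<le> integral {0..r0} (\<lambda>r. r ^ (N - 1) *
        ((if r \<in> {0..r0} then k' r else 0)\<^sup>2 - ?q r * (if r \<in> {0..r0} then k r else 0)\<^sup>2))"
      using st unfolding radially_stable_def by blast
    also have "\<dots> = integral {0..r0} (\<lambda>r. r ^ (N - 1) * ((k' r)\<^sup>2 - ?q r * (k r)\<^sup>2))"
      by (intro integral_cong) auto
    finally have 1: "0 \<le> integral {0..r0} (\<lambda>r. r ^ (N - 1) * ((k' r)\<^sup>2 - ?q r * (k r)\<^sup>2))" .
    \<comment> \<open>The boundary term: it vanishes at 0 because P does, and at r0 because w
      does.\<close>
    define B where "B = (\<lambda>r. - P r * (w r * (w r / (w r + \<delta>))\<^sup>2))"
    define B' where "B' = (\<lambda>r. - (r ^ (N - 1) * g r) * (w r * (w r / (w r + \<delta>))\<^sup>2)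
       + (- (r ^ (N - 1) * ?W r)) * (- ?W r * (w r / (w r + \<delta>))\<^sup>2
        + w r * (2 * (w r / (w r + \<delta>)) * (- ?W r * \<delta> / (w r + \<delta>)\<^sup>2))))"
    have "(B has_real_derivative B' r) (at r within {0..r0})" if r: "r \<in> {0..r0}" for r
    proof -
      have z: "((\<lambda>r. w r / (w r + \<delta>)) has_real_derivative - ?W r * \<delta> / (w r + \<delta>)\<^sup>2) (at r within {0..r0})"
        using nz[OF r \<delta>]
        by (auto intro!: derivative_eq_intros wr[OF r] simp: power2_eq_square algebra_simps)
      have prod: "((\<lambda>r. - p r * (x r * (y r)\<^sup>2)) has_real_derivative - p' * (x r * (y r)\<^sup>2) + - p r * (x' * (y r)\<^sup>2 + x r * (2 * y r * y'))) F"
        if "(p has_real_derivative p') F" "(x has_real_derivative x') F" "(y has_real_derivative y') F"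
          "F = at r within A" for p x y :: "real \<Rightarrow> real" and p' x' y' F A
        using that by (auto intro!: derivative_eq_intros simp: algebra_simps)
      have "0 \<le> r" using r by simp
      from prod[OF P[OF r] wr[OF r] z refl] show ?thesis
        unfolding B_def B'_def PW[OF \<open>0 \<le> r\<close>] .
    qed
    then have "(B' has_integral B r0 - B 0) {0..r0}"
      using r0 by (intro fundamental_theorem_of_calculus)
        (auto simp: has_real_derivative_iff_has_vector_derivative[symmetric])
    moreover have "B r0 = 0" "B 0 = 0" by (auto simp: B_def wr0 P_def)
    ultimately have B': "(B' has_integral 0) {0..r0}" by simp
    have "integral {0..r0} (\<lambda>r. r ^ (N - 1) * ((k' r)\<^sup>2 - ?q r * (k r)\<^sup>2)) = integral {0..r0} (\<lambda>r. B' r + (T \<delta> r - S \<delta> r))"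
    proof (rule integral_cong)
      fix r assume r: "r \<in> {0..r0}"
      show "r ^ (N - 1) * ((k' r)\<^sup>2 - ?q r * (k r)\<^sup>2) = B' r + (T \<delta> r - S \<delta> r)"
        unfolding k_def k'_def B'_def T_def S_def
        using comparison_test_identity[OF \<delta> w0[OF r], of "r ^ (N - 1)" "?W r" "?q r" "g r"]
        by (simp only: right_diff_distrib[symmetric])
    qed
    also have "\<dots> = 0 + (integral {0..r0} (T \<delta>) - integral {0..r0} (S \<delta>))"
      using cS[OF \<delta>] cT[OF \<delta>]
      by (intro integral_unique has_integral_add B' has_integral_diff integrable_integral integrable_continuous_real)
    finally show ?thesis using 1 by simp
  qed
  have diff0: "?q r * w r - g r > 0" if "0 < r" "r < r0" for r using less[OF that] by simp
  \<comment> \<open>S grows as \<delta> decreases, so S 1 is a lower bound independent of \<delta>.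
    The strict inequality is given only inside the interval; at the ends r^(N-1) or w is 0.\<close>
  have Sge: "S \<delta> r \<ge> S 1 r" if "0 < \<delta>" "\<delta> \<le> 1" "r \<in> {0..r0}" for \<delta> r
  proof (cases "r = 0 \<or> r = r0")
    case True then show ?thesis using wr0 N by (auto simp: S_def zero_power)
  next
    case False
    then have "w r / (w r + 1) \<le> w r / (w r + \<delta>)"
      using that w0[of r] by (intro divide_left_mono) (auto intro!: mult_pos_pos add_nonneg_pos)
    then have "(w r / (w r + 1))\<^sup>2 \<le> (w r / (w r + \<delta>))\<^sup>2"
      using w0[of r] that by (intro power_mono divide_nonneg_nonneg) auto
    then show ?thesis unfolding S_def
      using diff0[of r] w0[of r] that False by (intro mult_left_mono mult_nonneg_nonneg) auto
  qed
  have S1: "S 1 r \<ge> 0" if "r \<in> {0..r0}" for r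
  proof (cases "r = 0 \<or> r = r0")
    case True then show ?thesis using wr0 N by (auto simp: S_def zero_power)
  next
    case False then show ?thesis unfolding S_def
      using diff0[of r] w0[of r] that by (intro mult_nonneg_nonneg) auto
  qed
  have "integral {0..r0} (S 1) \<noteq> 0"
  proof
    assume "integral {0..r0} (S 1) = 0"
    then have "S 1 (r0 / 2) = 0"
      using integral_eq_0_iff[OF cS[of 1] r0 S1] r0 by auto
    moreover have "S 1 (r0 / 2) > 0" unfolding S_def
      using diff0[of "r0/2"] wpos[of "r0/2"] r0 by (intro mult_pos_pos zero_less_power divide_pos_pos) auto
    ultimately show False by simp
  qed
  moreover have "integral {0..r0} (S 1) \<ge> 0"
    using S1 cS[of 1] by (intro integral_nonneg integrable_continuous_real) auto
  ultimately have S1pos: "integral {0..r0} (S 1) > 0" by simp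
  define d where "d = (\<lambda>n. inverse (real (Suc n)))"
  have d: "d n > 0" "d n \<le> 1" for n by (auto simp: d_def field_simps)
  have dlim: "d \<longlonglongrightarrow> 0" unfolding d_def by (rule LIMSEQ_inverse_real_of_nat)
  have "(\<lambda>n. integral {0..r0} (T (d n))) \<longlonglongrightarrow> integral {0..r0} (\<lambda>r. 0)"
  \<comment> \<open>The majorant comes from w \<delta> <= (w + \<delta>)^2. Pointwise, T is 0 where
    w = 0 and carries the factor \<delta>^2 elsewhere.\<close>
  proof (rule dominated_convergence(2)[where h="\<lambda>r. r ^ (N - 1) * (?W r)\<^sup>2"])
    show "T (d n) integrable_on {0..r0}" for n by (intro integrable_continuous_real cT d)
    show "(\<lambda>r. r ^ (N - 1) * (?W r)\<^sup>2) integrable_on {0..r0}"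
      by (intro integrable_continuous_real continuous_intros cW)
    fix r assume r: "r \<in> {0..r0}"
    show "norm (T (d n) r) \<le> r ^ (N - 1) * (?W r)\<^sup>2" for n
    proof -
      have "w r * d n / (w r + d n)\<^sup>2 \<le> 1"
      proof -
        have "0 \<le> w r * w r + w r * d n + d n * d n"
          using w0[OF r] d(1)[of n] by (intro add_nonneg_nonneg mult_nonneg_nonneg) auto
        then have "w r * d n \<le> (w r + d n)\<^sup>2" by (simp add: power2_eq_square algebra_simps)
        moreover have "(w r + d n)\<^sup>2 > 0" using nz[OF r d(1)[of n]] by simp
        ultimately show ?thesis by simp
      qed
      then have "(w r * d n / (w r + d n)\<^sup>2)\<^sup>2 \<le> 1"
        using w0[OF r] d[of n] by (intro power_le_one) auto
      then have "(?W r)\<^sup>2 * (w r * d n / (w r + d n)\<^sup>2)\<^sup>2 \<le> (?W r)\<^sup>2 * 1"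
        by (intro mult_left_mono) auto
      then have "r ^ (N - 1) * (?W r * w r * d n / (w r + d n)\<^sup>2)\<^sup>2 \<le> r ^ (N - 1) * (?W r)\<^sup>2"
        using r by (intro mult_left_mono) (auto simp: power_mult_distrib power_divide algebra_simps)
      then show ?thesis using r by (simp add: T_def)
    qed
    show "(\<lambda>n. T (d n) r) \<longlonglongrightarrow> 0"
    proof (cases "w r = 0")
      case False
      then have "(\<lambda>n. T (d n) r) \<longlonglongrightarrow> r ^ (N - 1) * (?W r * w r * 0 / (w r + 0)\<^sup>2)\<^sup>2"
        unfolding T_def by (intro tendsto_intros dlim) auto
      then show ?thesis by simp
    qed (simp add: T_def)
  qed
  then have "(\<lambda>n. integral {0..r0} (T (d n))) \<longlonglongrightarrow> 0" by simp
  moreover have "integral {0..r0} (S 1) \<le> integral {0..r0} (T (d n))" for n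
  proof -
    have "integral {0..r0} (S 1) \<le> integral {0..r0} (S (d n))"
      using Sge d by (intro integral_le integrable_continuous_real cS) auto
    then show ?thesis using ineq[OF d(1)[of n]] by simp
  qed
  ultimately have "integral {0..r0} (S 1) \<le> 0"
    by (intro LIMSEQ_le_const[where X="\<lambda>n. integral {0..r0} (T (d n))"]) auto
  then show False using S1pos by simp
qed

text \<open>At the first failure either U \<beta> or U \<alpha> - U \<beta> vanishes, and neither
  may touch 0. For w = U \<beta> one has f(w) < f'(w) w <= f'(U \<alpha>) w; for the difference,
  convexity applies because U \<beta> is still positive up to that radius.\<close>

lemma radially_stable_order:
  assumes st: "radially_stable \<alpha>" and \<beta>: "0 < \<beta>" "\<beta> < \<alpha>" and r: "r \<ge> 0"
  shows "0 < U \<beta> r \<and> U \<beta> r < U \<alpha> r"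
proof (rule ccontr)
  assume neg: "\<not> (0 < U \<beta> r \<and> U \<beta> r < U \<alpha> r)"
  have \<alpha>: "\<alpha> > 0" using \<beta> by simp
  \<comment> \<open>Positivity of the minimum expresses both inequalities at once, so its first zero
    is the first failure of either.\<close>
  define m where "m = (\<lambda>r. min (U \<beta> r) (U \<alpha> r - U \<beta> r))"
  have cm: "continuous_on {0..} m" unfolding m_def
    by (intro continuous_intros continuous_U \<alpha> \<beta>)
  have m0: "m 0 > 0" using \<alpha> \<beta> by (simp add: m_def U_0)
  have mr: "m r \<le> 0" using neg by (auto simp: m_def)
  obtain r1 where r1: "r1 > 0" "m r1 = 0" "\<And>t. 0 \<le> t \<Longrightarrow> t < r1 \<Longrightarrow> m t > 0"
    using first_zero[OF cm m0 r mr] by blast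
  have pos: "0 < U \<beta> t" "U \<beta> t < U \<alpha> t" if "0 \<le> t" "t < r1" for t
    using r1(3)[OF that] by (auto simp: m_def)
  consider "U \<beta> r1 = 0" | "U \<alpha> r1 - U \<beta> r1 = 0" using r1(2) by (auto simp: m_def min_def split: if_splits)
  then show False
  proof cases
    case 1
    show False
    proof (rule radially_stable_no_touching[OF \<alpha> st r1(1) continuous_fU[OF \<beta>(1)] U_deriv[OF \<beta>(1)] _ 1])
      fix t assume t: "0 < t" "t < r1"
      have "f (U \<beta> t) < deriv f (U \<beta> t) * U \<beta> t"
        using f_diff_less[of 0 "U \<beta> t"] pos(1)[of t] t by (simp add: f_0)
      also have "\<dots> \<le> deriv f (U \<alpha> t) * U \<beta> t"
        using pos[of t] t by (intro mult_right_mono deriv_f_mono) auto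
      finally show "f (U \<beta> t) < deriv f (U \<alpha> t) * U \<beta> t" .
    qed (use pos in auto)
  next
    case 2
    show False
    proof (rule radially_stable_no_touching[OF \<alpha> st r1(1), where w="\<lambda>t. U \<alpha> t - U \<beta> t" and g="\<lambda>t. f (U \<alpha> t) - f (U \<beta> t)"])
      show "continuous_on {0..} (\<lambda>t. f (U \<alpha> t) - f (U \<beta> t))"
        by (intro continuous_intros continuous_fU \<alpha> \<beta>)
      fix t :: real
      show "((\<lambda>t. U \<alpha> t - U \<beta> t) has_real_derivative - radial_avg N (\<lambda>t. f (U \<alpha> t) - f (U \<beta> t)) t) (at t within {0..})" if "t \<ge> 0"
      proof -
        have "((\<lambda>t. U \<alpha> t - U \<beta> t) has_real_derivative - V \<alpha> t - (- V \<beta> t)) (at t within {0..})"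
          using that by (intro DERIV_diff U_deriv \<alpha> \<beta>)
        then show ?thesis by (simp add: radial_avg_diff[OF continuous_fU[OF \<alpha>] continuous_fU[OF \<beta>(1)]])
      qed
      show "f (U \<alpha> t) - f (U \<beta> t) < deriv f (U \<alpha> t) * (U \<alpha> t - U \<beta> t)" if "0 < t" "t < r1"
        using pos[of t] that by (intro f_diff_less) auto
    qed (use pos 2 in auto)
  qed
qed

end

section \<open>Instability for large initial values\<close>

text \<open>Squaring removes the kink of the positive part; the cutoff on [1, 2] is built from
  it.\<close>

lemma pos_part_square_deriv:
  "((\<lambda>x. (max 0 x)\<^sup>2) has_real_derivative 2 * max 0 x) (at (x::real))"
proof -
  consider "x < 0" | "x = 0" | "x > 0" by linarith
  then show ?thesis
  proof cases
    case 1
    have "((\<lambda>_. 0) has_real_derivative 2 * max 0 x) (at x)" using 1 by simp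
    then show ?thesis by (rule has_field_derivative_transform_within_open[of _ _ _ "{..<0}"]) (use 1 in auto)
  next
    case 3
    have "((\<lambda>x. x\<^sup>2) has_real_derivative 2 * max 0 x) (at x)" using 3 by (auto intro!: derivative_eq_intros)
    then show ?thesis by (rule has_field_derivative_transform_within_open[of _ _ _ "{0<..}"]) (use 3 in auto)
  next
    case 2
    have "((\<lambda>h::real. \<bar>h\<bar>) \<longlongrightarrow> \<bar>0\<bar>) (at 0)" by (intro tendsto_intros)
    then have "((\<lambda>h::real. \<bar>h\<bar>) \<longlongrightarrow> 0) (at 0)" by simp
    moreover have "\<forall>\<^sub>F h in at (0::real). norm ((max 0 h)\<^sup>2 / h) \<le> \<bar>h\<bar>"
      by (intro always_eventually allI) (auto simp: max_def power2_eq_square)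
    ultimately have "((\<lambda>h::real. (max 0 h)\<^sup>2 / h) \<longlongrightarrow> 0) (at 0)"
      by (rule Lim_null_comparison[rotated])
    then show ?thesis using 2 by (simp add: has_field_derivative_iff)
  qed
qed

text \<open>The quadratic form at \<open>h = v r s\<close> with \<open>v = - u'\<close>, where \<open>v' = d / r\<close> and \<open>x = r\<^sup>N\<^sup>-\<^sup>1\<close>: the left-hand side is the
  derivative of \<open>r x v d s\<^sup>2\<close>. Since \<open>u'\<close> solves the linearised equation up to the potential \<open>(N - 1) / r\<^sup>2\<close>,
  the nonlinearity drops out of the remainder.\<close>

lemma hardy_identity:
  fixes r x v s s' p q n :: real
  assumes "r > 0"
  defines "d \<equiv> r * p - (n - 1) * v"
  shows "n * x * (v * d * s\<^sup>2) + r * x * ((p - (n - 1) / r * v) * (d * s\<^sup>2) + v * ((p + r * (q * - v) - (n - 1) * (p - (n - 1) / r * v)) * s\<^sup>2 + d * (2 * s * s')))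
    = x * ((d * s + v * (s + r * s'))\<^sup>2 - q * (v * (r * s))\<^sup>2) - x * v\<^sup>2 * ((s + r * s')\<^sup>2 - (n - 1) * s\<^sup>2)"
  using assms(1) unfolding d_def by (simp add: field_simps power2_eq_square)

section \<open>The function F and the growth of f\<close>

context radial_problem begin

abbreviation F :: "real \<Rightarrow> real" where "F \<equiv> F_int f"

lemma inverse_f_integrable: "u > 0 \<Longrightarrow> set_integrable lborel {u..} (\<lambda>s. 1 / f s)"
  using standing by (simp add: standing_assumptions_def)

lemma continuous_inverse_f: "a > 0 \<Longrightarrow> continuous_on {a..} (\<lambda>s. 1 / f s)"
  by (intro continuous_intros continuous_f) (use f_pos in \<open>force simp: less_imp_neq[symmetric]\<close>)

lemma F_split:
  assumes "0 < u" "u \<le> v"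
  shows "F u = integral {u..v} (\<lambda>s. 1 / f s) + F v"
proof -
  have i: "(\<lambda>s. 1 / f s) integrable_on {w..}" "F w = integral {w..} (\<lambda>s. 1 / f s)" if "w > 0" for w
    using set_borel_integral_eq_integral[OF inverse_f_integrable[OF that]] by (auto simp: F_int_def)
  have "(\<lambda>s. 1 / f s) integrable_on {u..v}"
    using assms by (intro integrable_continuous_real continuous_on_subset[OF continuous_inverse_f]) auto
  then have "integral ({u..v} \<union> {v..}) (\<lambda>s. 1 / f s) = integral {u..v} (\<lambda>s. 1 / f s) + integral {v..} (\<lambda>s. 1 / f s)"
    using i[of v] assms by (intro integral_Un) auto
  moreover have "{u..v} \<union> {v..} = {u..}" using assms by auto
  ultimately show ?thesis using i(2)[of u] i(2)[of v] assms by simp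
qed

lemma F_deriv:
  assumes "u > 0"
  shows "(F has_real_derivative - 1 / f u) (at u)"
proof -
  define a where "a = u / 2"
  have a: "0 < a" "a < u" using assms by (auto simp: a_def)
  have "((\<lambda>x. integral {a..x} (\<lambda>s. 1 / f s)) has_real_derivative 1 / f u) (at u within {a..u+1})"
    using a by (intro integral_has_real_derivative continuous_on_subset[OF continuous_inverse_f]) auto
  moreover have "at u within {a..u+1} = at u" using a by (intro at_within_interior) auto
  ultimately have "((\<lambda>x. F a - integral {a..x} (\<lambda>s. 1 / f s)) has_real_derivative 0 - 1 / f u) (at u)"
    by (intro DERIV_diff DERIV_const) simp
  then have "(F has_real_derivative 0 - 1 / f u) (at u)"
  proof (rule has_field_derivative_transform_within_open[of _ _ _ "{a<..}"])
    show "F a - integral {a..x} (\<lambda>s. 1 / f s) = F x" if "x \<in> {a<..}" for x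
      using F_split[of a x] a that by simp
  qed (use a in auto)
  then show ?thesis by simp
qed

lemma F_nonneg: "u > 0 \<Longrightarrow> F u \<ge> 0"
  unfolding F_int_def set_lebesgue_integral_def using f_pos
  by (intro integral_nonneg_AE AE_I2) (auto simp: indicator_def less_imp_le)

lemma F_strict_antimono:
  assumes "0 < u" "u < v"
  shows "F v < F u"
proof (rule DERIV_neg_imp_decreasing[OF assms(2)])
  fix x assume "u \<le> x" "x \<le> v"
  note \<open>0 < u\<close> \<open>u \<le> x\<close>
  then have "f x > 0" using f_pos by simp
  then show "\<exists>y. (F has_real_derivative y) (at x) \<and> y < 0"
    using F_deriv[of x] \<open>0 < u\<close> \<open>u \<le> x\<close> by (intro exI[of _ "- 1 / f x"]) auto
qed

lemma F_pos: "u > 0 \<Longrightarrow> F u > 0"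
  using F_strict_antimono[of u "u + 1"] F_nonneg[of "u + 1"] by simp

lemma F_tendsto_0: "(F \<longlongrightarrow> 0) at_top"
proof -
  have "((\<lambda>b. LBINT s:{1..b}. 1 / f s) \<longlongrightarrow> F 1) at_top"
    unfolding F_int_def by (intro tendsto_set_lebesgue_integral_at_top inverse_f_integrable) auto
  then have "((\<lambda>b. F 1 - (LBINT s:{1..b}. 1 / f s)) \<longlongrightarrow> F 1 - F 1) at_top" by (intro tendsto_intros)
  moreover have "\<forall>\<^sub>F b in at_top. F 1 - (LBINT s:{1..b}. 1 / f s) = F b"
    using eventually_ge_at_top[of 1]
  proof eventually_elim
    case (elim b)
    have "set_integrable lborel {1..b} (\<lambda>s. 1 / f s)"
      by (rule set_integrable_subset[OF inverse_f_integrable[of 1]]) auto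
    then have "(LBINT s:{1..b}. 1 / f s) = integral {1..b} (\<lambda>s. 1 / f s)" by (rule set_borel_integral_eq_integral)
    then show ?case using F_split[of 1 b] elim by simp
  qed
  ultimately show ?thesis by (simp add: filterlim_cong)
qed

text \<open>For q0 < q' < q the derivative of f F^q' is F^(q'-1) (f' F - q'), eventually positive,
  so f F^q' stays above a positive constant. The remaining factor F^(q0-q') tends to
  infinity.\<close>

lemma f_F_powr_at_top:
  assumes lim: "((\<lambda>u. deriv f u * F u) \<longlongrightarrow> q) at_top" and q0: "q0 < q"
  shows "filterlim (\<lambda>u. f u * F u powr q0) at_top at_top"
proof -
  define q' where "q' = (q0 + q) / 2"
  have q': "q0 < q'" "q' < q" using q0 by (auto simp: q'_def)
  have "\<forall>\<^sub>F u in at_top. deriv f u * F u > q'" using order_tendstoD(1)[OF lim q'(2)] .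
  then obtain u0 where u0: "\<And>u. u \<ge> u0 \<Longrightarrow> deriv f u * F u > q'" by (auto simp: eventually_at_top_linorder)
  define u1 where "u1 = max u0 1"
  have u1: "u1 > 0" "u1 \<ge> u0" by (auto simp: u1_def)
  let ?\<Phi> = "\<lambda>u. f u * F u powr q'"
  have mono: "?\<Phi> u1 \<le> ?\<Phi> u" if "u \<ge> u1" for u
  proof (rule DERIV_nonneg_imp_nondecreasing[OF that])
    fix x assume x: "u1 \<le> x" "x \<le> u"
    then have x0: "x > 0" "f x > 0" "F x > 0" using u1 f_pos F_pos by auto
    have "(?\<Phi> has_real_derivative deriv f x * F x powr q' + f x * (q' * F x powr (q' - 1) * (- 1 / f x))) (at x)"
      using x0 by (auto intro!: derivative_eq_intros f_deriv F_deriv DERIV_fun_powr)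
    moreover have "deriv f x * F x powr q' + f x * (q' * F x powr (q' - 1) * (- 1 / f x)) = F x powr (q' - 1) * (deriv f x * F x - q')"
    proof -
      have "F x powr q' = F x powr (q' - 1) * F x" using x0 by (simp add: powr_diff)
      then show ?thesis using x0 by (simp add: algebra_simps)
    qed
    moreover have "F x powr (q' - 1) * (deriv f x * F x - q') \<ge> 0" using u0[of x] u1 x by simp
    ultimately show "\<exists>y. (?\<Phi> has_real_derivative y) (at x) \<and> 0 \<le> y" by auto
  qed
  have m: "?\<Phi> u1 > 0" using f_pos[OF u1(1)] F_pos[OF u1(1)] by simp
  have "((\<lambda>u. F u powr (q' - q0)) \<longlongrightarrow> 0) at_top"
  proof (rule tendsto_zero_powrI[OF F_tendsto_0 tendsto_const])
    show "\<forall>\<^sub>F u in at_top. 0 \<le> F u"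
      using eventually_gt_at_top[of 0] by eventually_elim (rule F_nonneg)
  qed (use q' in simp)
  moreover have "\<forall>\<^sub>F u in at_top. 0 < F u powr (q' - q0)"
    using eventually_gt_at_top[of 0] by eventually_elim (use F_pos in force)
  ultimately have "filterlim (\<lambda>u. inverse (F u powr (q' - q0))) at_top at_top"
    by (rule filterlim_inverse_at_top)
  then have "filterlim (\<lambda>u. ?\<Phi> u1 * inverse (F u powr (q' - q0))) at_top at_top"
    using m by (intro filterlim_tendsto_pos_mult_at_top[OF tendsto_const])
  then show ?thesis
  proof (rule filterlim_at_top_mono)
    show "\<forall>\<^sub>F u in at_top. ?\<Phi> u1 * inverse (F u powr (q' - q0)) \<le> f u * F u powr q0"
      using eventually_ge_at_top[of u1]
    proof eventually_elim
      case (elim u)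
      then have "u > 0" using u1 by simp
      have "?\<Phi> u1 * inverse (F u powr (q' - q0)) \<le> ?\<Phi> u * inverse (F u powr (q' - q0))"
        using mono[OF elim] by (intro mult_right_mono) auto
      also have "\<dots> = f u * F u powr q0"
        using F_pos[OF \<open>u > 0\<close>] by (simp add: powr_diff field_simps)
      finally show ?case .
    qed
  qed
qed

section \<open>A Hardy type inequality for stable solutions\<close>

text \<open>Stability is tested with V \<zeta> for \<zeta> = r \<sigma>. Writing \<zeta> this way
  turns (N-1) \<zeta>^2 / r^2 into (N-1) \<sigma>^2, so no singular integrand appears.\<close>

lemma radially_stable_hardy:
  assumes \<alpha>: "\<alpha> > 0" and st: "radially_stable \<alpha>"
    and \<sigma>: "\<And>r. 0 \<le> r \<Longrightarrow> r \<le> 2 \<Longrightarrow> (\<sigma> has_real_derivative \<sigma>' r) (at r)"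
    and c\<sigma>': "continuous_on {0..2} \<sigma>'" and z: "\<sigma> 2 = 0" "\<sigma>' 2 = 0"
  shows "0 \<le> integral {0..2} (\<lambda>r. r ^ (N - 1) * (V \<alpha> r)\<^sup>2 * ((\<sigma> r + r * \<sigma>' r)\<^sup>2 - (real N - 1) * (\<sigma> r)\<^sup>2))"
proof -
  let ?V = "V \<alpha>" and ?u = "U \<alpha>"
  define d where "d = (\<lambda>r. r * f (?u r) - (real N - 1) * ?V r)"
  define h where "h = (\<lambda>r. ?V r * (r * \<sigma> r))"
  define h' where "h' = (\<lambda>r. d r * \<sigma> r + ?V r * (\<sigma> r + r * \<sigma>' r))"
  have c\<sigma>: "continuous_on {0..2} \<sigma>" using \<sigma> by (intro DERIV_continuous_on) (auto intro: has_field_derivative_at_within)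
  have cV: "continuous_on {0..2} ?V" by (rule continuous_on_subset[OF continuous_V[OF \<alpha>]]) auto
  have cf: "continuous_on {0..2} (\<lambda>r. f (?u r))" by (rule continuous_on_subset[OF continuous_fU[OF \<alpha>]]) auto
  have cq: "continuous_on {0..2} (\<lambda>r. deriv f (?u r))" by (rule continuous_on_subset[OF continuous_dfU[OF \<alpha>]]) auto
  have cd: "continuous_on {0..2} d" unfolding d_def by (intro continuous_intros cf cV)
  have V': "(?V has_real_derivative f (?u r) - (real N - 1) / r * ?V r) (at r)" if "r > 0" for r
    using radial_avg_deriv[OF continuous_fU[OF \<alpha>] that N_ge_1] .
  have "radial_test (\<lambda>r. if r \<in> {0..2} then h r else 0) (\<lambda>r. if r \<in> {0..2} then h' r else 0) 2"
  proof (rule radial_test_truncation)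
    fix r :: real assume r: "0 \<le> r" "r \<le> 2"
    show "(h has_real_derivative h' r) (at r within {0..2})"
    proof (cases "r = 0")
      case False
      then have "(h has_real_derivative (f (?u r) - (real N - 1) / r * ?V r) * (r * \<sigma> r) + (1 * \<sigma> r + \<sigma>' r * r) * ?V r) (at r)"
        unfolding h_def using r by (intro DERIV_mult DERIV_ident V' \<sigma>) auto
      moreover have "(f (?u r) - (real N - 1) / r * ?V r) * (r * \<sigma> r) + (1 * \<sigma> r + \<sigma>' r * r) * ?V r = h' r"
        unfolding h'_def d_def using False by (simp add: field_simps)
      ultimately show ?thesis by (auto intro: has_field_derivative_at_within)
    next
      case True
      have "continuous_on {0..2} (\<lambda>r. ?V r * \<sigma> r)" by (intro continuous_intros cV c\<sigma>)
      then have "((\<lambda>r. ?V r * \<sigma> r) \<longlongrightarrow> ?V 0 * \<sigma> 0) (at 0 within {0..2})"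
        unfolding continuous_on_def by (rule bspec) simp
      then have "((\<lambda>r. ?V r * \<sigma> r) \<longlongrightarrow> 0) (at 0 within {0..2})" by simp
      moreover have "\<forall>\<^sub>F r in at 0 within {0..2}. ?V r * \<sigma> r = (h r - h 0) / (r - 0)"
        by (auto simp: eventually_at_filter h_def)
      ultimately have "((\<lambda>r. (h r - h 0) / (r - 0)) \<longlongrightarrow> 0) (at 0 within {0..2})"
        by (rule Lim_transform_eventually)
      then show ?thesis using True by (simp add: has_field_derivative_iff h'_def d_def)
    qed
  next
    show "continuous_on {0..2} h'" unfolding h'_def
      by (intro continuous_intros cd c\<sigma> cV c\<sigma>')
  qed (use z in \<open>auto simp: h_def h'_def d_def\<close>)
  then have "0 \<le> integral {0..2} (\<lambda>r. r ^ (N - 1) *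
      ((if r \<in> {0..2} then h' r else 0)\<^sup>2 - deriv f (?u r) * (if r \<in> {0..2} then h r else 0)\<^sup>2))"
    using st unfolding radially_stable_def by blast
  also have "\<dots> = integral {0..2} (\<lambda>r. r ^ (N - 1) * ((h' r)\<^sup>2 - deriv f (?u r) * (h r)\<^sup>2))"
    by (intro integral_cong) auto
  finally have 1: "0 \<le> integral {0..2} (\<lambda>r. r ^ (N - 1) * ((h' r)\<^sup>2 - deriv f (?u r) * (h r)\<^sup>2))" .
  let ?K = "\<lambda>r. r ^ (N - 1) * ((h' r)\<^sup>2 - deriv f (?u r) * (h r)\<^sup>2)"
  let ?G = "\<lambda>r. r ^ (N - 1) * (?V r)\<^sup>2 * ((\<sigma> r + r * \<sigma>' r)\<^sup>2 - (real N - 1) * (\<sigma> r)\<^sup>2)"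
  \<comment> \<open>The primitive from \<open>hardy_identity\<close>. It vanishes at 0 by its power
    of r and at 2 because \<sigma> does; a derivative in the open interval and continuity at the
    ends suffice.\<close>
  define B where "B = (\<lambda>r. r ^ N * (?V r * (d r * (\<sigma> r)\<^sup>2)))"
  have "((\<lambda>r. ?K r - ?G r) has_integral B 2 - B 0) {0..2}"
  proof (rule fundamental_theorem_of_calculus_interior)
    show "continuous_on {0..2} B" unfolding B_def by (intro continuous_intros cV cd c\<sigma>)
    fix r :: real assume r: "r \<in> {0<..<2}"
    then have r0: "r > 0" by simp
    have u': "(?u has_real_derivative - ?V r) (at r)"
      using U_deriv[OF \<alpha>, of r] r0 by (simp add: at_within_atLeast_0)
    have fu: "((\<lambda>r. f (?u r)) has_real_derivative deriv f (?u r) * - ?V r) (at r)"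
      by (rule DERIV_chain2[OF f_deriv u'])
    have d': "(d has_real_derivative f (?u r) + r * (deriv f (?u r) * - ?V r) - (real N - 1) * (f (?u r) - (real N - 1) / r * ?V r)) (at r)"
      unfolding d_def by (rule derivative_eq_intros fu V'[OF r0] refl | simp)+
    have prod: "((\<lambda>r. r ^ N * (x r * (y r * (s r)\<^sup>2))) has_real_derivative
        real N * r ^ (N - 1) * (x r * y r * (s r)\<^sup>2) + r ^ N * (x' * (y r * (s r)\<^sup>2) + x r * (y' * (s r)\<^sup>2 + y r * (2 * s r * s')))) (at r)"
      if "(x has_real_derivative x') (at r)" "(y has_real_derivative y') (at r)" "(s has_real_derivative s') (at r)"
      for x y s :: "real \<Rightarrow> real" and x' y' s'
      using that by (auto intro!: derivative_eq_intros simp: algebra_simps)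
    have "r ^ N = r * r ^ (N - 1)" using N by (simp flip: power_Suc)
    with prod[OF V'[OF r0] d' \<sigma>, of] r
      hardy_identity[OF r0, of "real N" "r ^ (N - 1)" "?V r" "f (?u r)" "\<sigma> r" "deriv f (?u r)" "\<sigma>' r"]
    show "(B has_vector_derivative ?K r - ?G r) (at r)"
      unfolding has_real_derivative_iff_has_vector_derivative[symmetric]
      by (simp add: B_def h_def h'_def d_def)
  qed simp
  moreover have "B 2 = 0" "B 0 = 0" using N z by (auto simp: B_def zero_power)
  ultimately have zero: "((\<lambda>r. ?K r - ?G r) has_integral 0) {0..2}" by simp
  have "?K integrable_on {0..2}" unfolding h_def h'_def
    by (intro integrable_continuous_real continuous_intros cd c\<sigma> cV c\<sigma>' cq)
  moreover have "?G integrable_on {0..2}"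
    by (intro integrable_continuous_real continuous_intros c\<sigma> cV c\<sigma>')
  ultimately have "((\<lambda>r. ?K r - ?G r) has_integral integral {0..2} ?K - integral {0..2} ?G) {0..2}"
    by (intro has_integral_diff integrable_integral)
  from has_integral_unique[OF this zero] have "integral {0..2} ?K - integral {0..2} ?G = 0" .
  then show ?thesis using 1 by simp
qed

end

text \<open>Meant for a^2 = N - 1 and \<rho> = r^2 / (\<epsilon>^2 + r^2). The expression 1 - (a+1)
  \<rho> runs from 1 down to -a, so its square never exceeds a^2; on \<rho> <= 1/2, that is r <=
  \<epsilon>, it stays below by at least 1.\<close>

lemma cutoff_algebra:
  fixes a \<rho> :: real
  assumes a: "a \<ge> 3" and \<rho>: "0 \<le> \<rho>" "\<rho> \<le> 1"
  shows "\<bar>1 - (a + 1) * \<rho>\<bar> \<le> a" and "\<rho> \<le> 1 / 2 \<Longrightarrow> (1 - (a + 1) * \<rho>)\<^sup>2 \<le> a\<^sup>2 - 1"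
proof -
  define p where "p = (a + 1) * \<rho>"
  have "(a + 1) * \<rho> \<le> (a + 1) * 1" using a \<rho> by (intro mult_left_mono) auto
  then have 1: "0 \<le> p" "p \<le> a + 1" using a \<rho> by (auto simp: p_def)
  then show "\<bar>1 - (a + 1) * \<rho>\<bar> \<le> a" using a unfolding p_def[symmetric] by linarith
  assume "\<rho> \<le> 1 / 2"
  then have "(a + 1) * \<rho> \<le> (a + 1) * (1 / 2)" using a by (intro mult_left_mono) auto
  then have "2 * p \<le> a + 1" by (simp add: p_def)
  then have "\<bar>1 - p\<bar> \<le> \<bar>a - 1\<bar>" using 1 a by linarith
  then have "(1 - (a + 1) * \<rho>)\<^sup>2 \<le> (a - 1)\<^sup>2" unfolding p_def by (simp only: abs_le_square_iff)
  also have "\<dots> \<le> a\<^sup>2 - 1" using a by (simp add: power2_eq_square algebra_simps)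
  finally show "(1 - (a + 1) * \<rho>)\<^sup>2 \<le> a\<^sup>2 - 1" .
qed

section \<open>A priori bounds for a radially stable solution\<close>

context radial_problem begin

context
  fixes \<alpha> :: real
  assumes \<alpha>: "\<alpha> > 0" and st: "radially_stable \<alpha>"
begin

text \<open>Positivity comes from ordering against a smaller initial value: 0 < U(\<alpha>/2) <
  U(\<alpha>).\<close>

lemma stable_U_pos: "r \<ge> 0 \<Longrightarrow> U \<alpha> r > 0"
  using radially_stable_order[OF st, of "\<alpha> / 2" r] \<alpha> by simp

lemma stable_U_deriv: "r > 0 \<Longrightarrow> (U \<alpha> has_real_derivative - V \<alpha> r) (at r)"
  using U_deriv[OF \<alpha>, of r] by (simp add: at_within_atLeast_0)

lemma stable_V_nonneg: "r \<ge> 0 \<Longrightarrow> V \<alpha> r \<ge> 0"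
  using radial_avg_ge[OF continuous_fU[OF \<alpha>], of r 0 N] f_pos[OF stable_U_pos] N_ge_1
  by (simp add: less_imp_le)

lemma stable_U_antimono:
  assumes "0 \<le> r" "r \<le> s"
  shows "U \<alpha> s \<le> U \<alpha> r"
proof (rule DERIV_nonpos_imp_decreasing_open[OF assms(2)])
  show "continuous_on {r..s} (U \<alpha>)" by (rule continuous_on_subset[OF continuous_U[OF \<alpha>]]) (use assms in auto)
  fix x assume "r < x" "x < s"
  then show "\<exists>y. (U \<alpha> has_real_derivative y) (at x) \<and> y \<le> 0"
    using stable_U_deriv[of x] stable_V_nonneg[of x] assms by (intro exI[of _ "- V \<alpha> x"]) auto
qed

lemma stable_V_ge:
  assumes "r \<ge> 0" "B \<le> f (U \<alpha> r)"
  shows "B * r / real N \<le> V \<alpha> r"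
proof (rule radial_avg_ge[OF continuous_fU[OF \<alpha>] _ assms(1) N_ge_1])
  fix t assume t: "0 \<le> t" "t \<le> r"
  have "f (U \<alpha> r) \<le> f (U \<alpha> t)"
    using stable_U_pos[of r] assms(1) by (intro f_mono stable_U_antimono t) auto
  then show "B \<le> f (U \<alpha> t)" using assms by simp
qed

lemma stable_V_le: "r \<ge> 0 \<Longrightarrow> V \<alpha> r \<le> f \<alpha> * r / real N"
  using stable_U_pos U_abs_le[OF \<alpha>]
  by (intro radial_avg_le[OF continuous_fU[OF \<alpha>] f_mono _ N_ge_1]) (auto simp: less_imp_le abs_le_iff)

text \<open>Integrates u' = -V >= - f(\<alpha>) r / N. It controls how far u drops on the inner
  interval [0, \<epsilon>].\<close>

lemma stable_U_ge:
  assumes "r \<ge> 0"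
  shows "\<alpha> - f \<alpha> * r\<^sup>2 / (2 * real N) \<le> U \<alpha> r"
proof -
  have "U \<alpha> 0 + f \<alpha> * 0\<^sup>2 / (2 * real N) \<le> U \<alpha> r + f \<alpha> * r\<^sup>2 / (2 * real N)"
  proof (rule DERIV_nonneg_imp_increasing_open[OF assms])
    show "continuous_on {0..r} (\<lambda>r. U \<alpha> r + f \<alpha> * r\<^sup>2 / (2 * real N))"
      using N by (intro continuous_intros continuous_on_subset[OF continuous_U[OF \<alpha>]]) auto
    fix x assume x: "0 < x" "x < r"
    have "((\<lambda>r. U \<alpha> r + f \<alpha> * r\<^sup>2 / (2 * real N)) has_real_derivative - V \<alpha> x + f \<alpha> * x / real N) (at x)"
      using N x by (auto intro!: derivative_eq_intros stable_U_deriv)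
    then show "\<exists>y. ((\<lambda>r. U \<alpha> r + f \<alpha> * r\<^sup>2 / (2 * real N)) has_real_derivative y) (at x) \<and> 0 \<le> y"
      using stable_V_le[of x] x by (intro exI[of _ "- V \<alpha> x + f \<alpha> * x / real N"]) auto
  qed
  then show ?thesis using U_0[OF \<alpha>] by simp
qed

text \<open>The derivative of F(u) is V / f(u) >= r / N, because u decreases and hence V >= f(u) r /
  N. The bound does not depend on \<alpha>.\<close>

lemma stable_F_U_ge:
  assumes "r \<ge> 0"
  shows "r\<^sup>2 / (2 * real N) \<le> F (U \<alpha> r)"
proof -
  have "F (U \<alpha> 0) - 0\<^sup>2 / (2 * real N) \<le> F (U \<alpha> r) - r\<^sup>2 / (2 * real N)"
  proof (rule DERIV_nonneg_imp_increasing_open[OF assms])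
    have "continuous_on {0<..} F"
      using F_deriv by (intro DERIV_continuous_on) (auto intro: has_field_derivative_at_within)
    then show "continuous_on {0..r} (\<lambda>r. F (U \<alpha> r) - r\<^sup>2 / (2 * real N))"
      using N stable_U_pos
      by (intro continuous_intros continuous_on_compose2[OF _ continuous_on_subset[OF continuous_U[OF \<alpha>]]]) auto
    fix x assume x: "0 < x" "x < r"
    have pos: "f (U \<alpha> x) > 0" using stable_U_pos[of x] f_pos x by simp
    have "((\<lambda>r. F (U \<alpha> r)) has_real_derivative - 1 / f (U \<alpha> x) * - V \<alpha> x) (at x)"
      using x by (intro DERIV_chain2[OF F_deriv stable_U_deriv] stable_U_pos) auto
    then have "((\<lambda>r. F (U \<alpha> r) - r\<^sup>2 / (2 * real N)) has_real_derivative - 1 / f (U \<alpha> x) * - V \<alpha> x - x / real N) (at x)"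
      using N by (auto intro!: derivative_eq_intros)
    moreover have "- 1 / f (U \<alpha> x) * - V \<alpha> x - x / real N \<ge> 0"
      using stable_V_ge[of x "f (U \<alpha> x)"] pos x by (simp add: field_simps)
    ultimately show "\<exists>y. ((\<lambda>r. F (U \<alpha> r) - r\<^sup>2 / (2 * real N)) has_real_derivative y) (at x) \<and> 0 \<le> y" by blast
  qed
  then show ?thesis using U_0[OF \<alpha>] F_nonneg[OF \<alpha>] by simp
qed

text \<open>The mean value theorem gives s in (t, t+1) with V(s) = u(t) - u(t+1) <= u(1). As r^(N-1)
  V is nondecreasing and s <= 2 t, going back from s to t costs at most 2^(N-1).\<close>

lemma stable_V_outer:
  assumes t: "1 \<le> t"
  shows "V \<alpha> t \<le> 2 ^ (N - 1) * U \<alpha> 1"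
proof -
  have "\<exists>z>t. z < t + 1 \<and> U \<alpha> (t + 1) - U \<alpha> t = (t + 1 - t) * - V \<alpha> z"
    using MVT2[of t "t + 1" "U \<alpha>" "\<lambda>z. - V \<alpha> z"] stable_U_deriv t by auto
  then obtain s where s: "t < s" "s < t + 1" "U \<alpha> (t + 1) - U \<alpha> t = - V \<alpha> s" by auto
  let ?g = "\<lambda>x. x ^ (N - 1) * f (U \<alpha> x)"
  have P: "r ^ (N - 1) * V \<alpha> r = integral {0..r} ?g" if "r > 0" for r
    using that by (simp add: radial_avg_def)
  have "integral {0..t} ?g \<le> integral {0..s} ?g"
    using s t f_pos[OF stable_U_pos]
    by (intro integral_subset_le integrable_on_weighted continuous_fU[OF \<alpha>]) (auto intro!: mult_nonneg_nonneg simp: less_imp_le)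
  then have "t ^ (N - 1) * V \<alpha> t \<le> s ^ (N - 1) * V \<alpha> s" using P[of t] P[of s] s t by simp
  also have "\<dots> \<le> (2 * t) ^ (N - 1) * V \<alpha> s"
    using s t stable_V_nonneg[of s] by (intro mult_right_mono power_mono) auto
  finally have "t ^ (N - 1) * V \<alpha> t \<le> t ^ (N - 1) * (2 ^ (N - 1) * V \<alpha> s)"
    by (simp add: power_mult_distrib algebra_simps)
  then have "V \<alpha> t \<le> 2 ^ (N - 1) * V \<alpha> s" using t by (simp add: mult_le_cancel_left)
  also have "V \<alpha> s \<le> U \<alpha> 1" using s(3) stable_U_pos[of "t + 1"] stable_U_antimono[of 1 t] t by simp
  finally show ?thesis by simp
qed

end

section \<open>The quantitative estimate and instability for large initial values\<close>

text \<open>The Hardy integral is split at \<epsilon> and 1. The inner part is negative and at least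
  as large in size as the left-hand side, the middle part is nonpositive, and the cutoff region
  contributes at most the right-hand side.\<close>

lemma radially_stable_estimate:
  fixes \<epsilon> M :: real
  assumes \<alpha>: "\<alpha> > 0" and st: "radially_stable \<alpha>" and \<epsilon>: "0 < \<epsilon>" "\<epsilon> \<le> 1"
    and low: "f \<alpha> / 2 \<le> f (U \<alpha> \<epsilon>)" and M: "U \<alpha> 1 \<le> M"
  defines "a \<equiv> sqrt (real N - 1)"
  shows "(f \<alpha> / (2 * real N))\<^sup>2 * (2 * \<epsilon>\<^sup>2) powr (- (a + 1)) * (\<epsilon> ^ (N + 2) / real (N + 2))
    \<le> 2 ^ (N - 1) * (2 ^ (N - 1) * M)\<^sup>2 * (a + 8)\<^sup>2"
proof -
  have a2: "a\<^sup>2 = real N - 1" using N by (simp add: a_def)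
  have a: "a \<ge> 3" unfolding a_def using N by (intro real_le_rsqrt) auto
  define k where "k = a + 1"
  \<comment> \<open>The square of y is differentiable at 1, and the outer square in \<eta> makes
    \<eta> and its derivative vanish at 2, as the Hardy inequality requires.\<close>
  define y where "y = (\<lambda>r::real. max 0 (r - 1))"
  define \<eta> where "\<eta> = (\<lambda>r. (1 - (y r)\<^sup>2)\<^sup>2)"
  define \<eta>' where "\<eta>' = (\<lambda>r. 2 * (1 - (y r)\<^sup>2) * - (2 * y r))"
  \<comment> \<open>\<open>r s(r)\<close> behaves like \<open>r\<close> below \<open>\<epsilon>\<close> and like the borderline power \<open>r\<^sup>-\<^sup>a\<close> above, where
    \<open>(r s)'\<^sup>2 \<le> (N - 1) s\<^sup>2\<close> still holds; \<open>\<eta>\<close> cuts off between 1 and 2.\<close>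
  define s where "s = (\<lambda>r. (\<epsilon>\<^sup>2 + r\<^sup>2) powr (- k / 2))"
  define s' where "s' = (\<lambda>r. - k / 2 * (\<epsilon>\<^sup>2 + r\<^sup>2) powr (- k / 2 - 1) * (2 * r))"
  define \<sigma> where "\<sigma> = (\<lambda>r. s r * \<eta> r)"
  define \<sigma>' where "\<sigma>' = (\<lambda>r. s' r * \<eta> r + \<eta>' r * s r)"
  have pos: "\<epsilon>\<^sup>2 + r\<^sup>2 > 0" for r :: real using \<epsilon> by (intro add_pos_nonneg) auto
  have dy: "((\<lambda>r. (y r)\<^sup>2) has_real_derivative 2 * y r) (at r)" for r
  proof -
    have "((\<lambda>r. r - 1) has_real_derivative 1) (at r)" by (auto intro!: derivative_eq_intros)
    from DERIV_chain2[OF pos_part_square_deriv this] show ?thesis by (simp add: y_def)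
  qed
  have d\<eta>: "(\<eta> has_real_derivative \<eta>' r) (at r)" for r
  proof -
    have g: "((\<lambda>r. 1 - (y r)\<^sup>2) has_real_derivative 0 - 2 * y r) (at r)"
      by (rule DERIV_diff[OF DERIV_const dy])
    show ?thesis using DERIV_mult[OF g g]
      by (simp add: \<eta>_def \<eta>'_def power2_eq_square algebra_simps)
  qed
  have ds: "(s has_real_derivative s' r) (at r)" for r
  proof -
    have "((\<lambda>r. \<epsilon>\<^sup>2 + r\<^sup>2) has_real_derivative 2 * r) (at r)" by (auto intro!: derivative_eq_intros)
    from DERIV_fun_powr[OF this pos, of "- k / 2"] show ?thesis by (simp add: s_def s'_def)
  qed
  have d\<sigma>: "(\<sigma> has_real_derivative \<sigma>' r) (at r)" for r
    unfolding \<sigma>_def \<sigma>'_def by (rule DERIV_mult[OF ds d\<eta>])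
  have cy: "continuous_on A y" for A unfolding y_def by (intro continuous_intros)
  have c\<eta>: "continuous_on A \<eta>" "continuous_on A \<eta>'" for A
    unfolding \<eta>_def \<eta>'_def by (intro continuous_intros cy)+
  have cs: "continuous_on A s" "continuous_on A s'" for A
    unfolding s_def s'_def using pos less_imp_neq by (fastforce intro!: continuous_intros)+
  have c\<sigma>: "continuous_on A \<sigma>" "continuous_on A \<sigma>'" for A
    unfolding \<sigma>_def \<sigma>'_def by (intro continuous_intros c\<eta> cs)+
  define E where "E = (\<lambda>r. (\<sigma> r + r * \<sigma>' r)\<^sup>2 - (real N - 1) * (\<sigma> r)\<^sup>2)"
  define G where "G = (\<lambda>r. r ^ (N - 1) * (V \<alpha> r)\<^sup>2 * E r)"
  have cG: "continuous_on {0..2} G" unfolding G_def E_def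
    by (intro continuous_intros c\<sigma> continuous_on_subset[OF continuous_V[OF \<alpha>]]) auto
  have "0 \<le> integral {0..2} G" unfolding G_def E_def
    by (rule radially_stable_hardy[OF \<alpha> st d\<sigma> c\<sigma>(2)]) (auto simp: \<sigma>_def \<sigma>'_def \<eta>_def \<eta>'_def y_def)
  \<comment> \<open>Up to the factor -k this is r s' / s; it passes from 0 at the origin to nearly 1
    for r much larger than \<epsilon>.\<close>
  define \<rho> where "\<rho> = (\<lambda>r. r\<^sup>2 / (\<epsilon>\<^sup>2 + r\<^sup>2))"
  have \<rho>: "0 \<le> \<rho> r" "\<rho> r \<le> 1" for r using pos[of r] by (auto simp: \<rho>_def)
  have rs': "r * s' r = - k * \<rho> r * s r" for r
  proof -
    have "(\<epsilon>\<^sup>2 + r\<^sup>2) powr (- k / 2 - 1) = s r / (\<epsilon>\<^sup>2 + r\<^sup>2)" using pos[of r] by (simp add: s_def powr_diff)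
    then show ?thesis by (simp add: s'_def \<rho>_def power2_eq_square)
  qed
  have Eeq: "E r = (s r)\<^sup>2 * (((1 - k * \<rho> r) * \<eta> r + r * \<eta>' r)\<^sup>2 - a\<^sup>2 * (\<eta> r)\<^sup>2)" for r
  proof -
    have eq: "\<sigma> r + r * \<sigma>' r = s r * ((1 - k * \<rho> r) * \<eta> r + r * \<eta>' r)"
    proof -
      have "\<sigma> r + r * \<sigma>' r = s r * \<eta> r + (r * s' r) * \<eta> r + r * \<eta>' r * s r"
        by (simp add: \<sigma>_def \<sigma>'_def algebra_simps)
      then show ?thesis unfolding rs' by (simp add: algebra_simps)
    qed
    have "(s r * z)\<^sup>2 - b * (s r * x)\<^sup>2 = (s r)\<^sup>2 * (z\<^sup>2 - b * x\<^sup>2)" for z b x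
      by (simp add: power_mult_distrib algebra_simps)
    moreover have "\<sigma> r = s r * \<eta> r" by (simp add: \<sigma>_def)
    ultimately show ?thesis unfolding E_def eq a2 by simp
  qed
  have s2: "(s r)\<^sup>2 = (\<epsilon>\<^sup>2 + r\<^sup>2) powr (- k)" for r
    unfolding s_def using pos[of r] by (simp add: power2_eq_square powr_add[symmetric])
  have inner: "E r = (s r)\<^sup>2 * ((1 - k * \<rho> r)\<^sup>2 - a\<^sup>2)" if "0 \<le> r" "r \<le> 1" for r
    unfolding Eeq using that by (simp add: \<eta>_def \<eta>'_def y_def)
  have E0: "E r \<le> 0" if "0 \<le> r" "r \<le> 1" for r
  proof -
    have "(1 - k * \<rho> r)\<^sup>2 \<le> a\<^sup>2" using cutoff_algebra(1)[OF a \<rho>, of r] a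
      unfolding k_def by (simp add: abs_le_square_iff[symmetric])
    then show ?thesis unfolding inner[OF that] by (intro mult_nonneg_nonpos) auto
  qed
  \<comment> \<open>For r <= \<epsilon> the bracket in E is at most -1, and \<epsilon>^2 + r^2 <= 2
    \<epsilon>^2 bounds s^2 from below.\<close>
  have E1: "E r \<le> - ((2 * \<epsilon>\<^sup>2) powr (- k))" if "0 \<le> r" "r \<le> \<epsilon>" for r
  proof -
    have r2: "r\<^sup>2 \<le> \<epsilon>\<^sup>2" using that by (intro power_mono) auto
    then have "\<rho> r \<le> 1 / 2" using pos[of r] by (simp add: \<rho>_def divide_le_eq)
    then have "(1 - k * \<rho> r)\<^sup>2 - a\<^sup>2 \<le> - 1" using cutoff_algebra(2)[OF a \<rho>, of r] unfolding k_def by simp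
    then have "(s r)\<^sup>2 * ((1 - k * \<rho> r)\<^sup>2 - a\<^sup>2) \<le> (s r)\<^sup>2 * (- 1)" by (intro mult_left_mono) auto
    moreover have "(2 * \<epsilon>\<^sup>2) powr (- k) \<le> (\<epsilon>\<^sup>2 + r\<^sup>2) powr (- k)"
      using r2 pos[of r] a by (intro powr_mono2') (auto simp: k_def)
    ultimately show ?thesis using inner[of r] that \<epsilon> s2[of r] by simp
  qed
  \<comment> \<open>On [1, 2]: s <= 1, the first summand is at most a in size, and |r \<eta>'| <= 2
    * 4.\<close>
  have E2: "E r \<le> (a + 8)\<^sup>2" if "1 \<le> r" "r \<le> 2" for r
  proof -
    have y: "0 \<le> y r" "y r \<le> 1" using that by (auto simp: y_def)
    then have y2: "0 \<le> 1 - (y r)\<^sup>2" "1 - (y r)\<^sup>2 \<le> 1" using power_le_one[of "y r" 2] by auto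
    then have \<eta>1: "\<bar>\<eta> r\<bar> \<le> 1" unfolding \<eta>_def using power_le_one[of "1 - (y r)\<^sup>2" 2] by simp
    have "(1 - (y r)\<^sup>2) * y r \<le> 1 * 1" using y y2 by (intro mult_mono) auto
    moreover have "\<bar>\<eta>' r\<bar> = 4 * ((1 - (y r)\<^sup>2) * y r)"
    proof -
      have "\<eta>' r = - (4 * ((1 - (y r)\<^sup>2) * y r))" by (simp add: \<eta>'_def algebra_simps)
      then show ?thesis using y y2 by simp
    qed
    ultimately have "\<bar>\<eta>' r\<bar> \<le> 4" by simp
    then have "\<bar>r * \<eta>' r\<bar> \<le> 2 * 4" unfolding abs_mult using that by (intro mult_mono) auto
    moreover have "\<bar>(1 - k * \<rho> r) * \<eta> r\<bar> \<le> a * 1"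
      unfolding abs_mult using \<eta>1 cutoff_algebra(1)[OF a \<rho>, of r] a by (intro mult_mono) (auto simp: k_def)
    ultimately have "\<bar>(1 - k * \<rho> r) * \<eta> r + r * \<eta>' r\<bar> \<le> \<bar>a + 8\<bar>" using a by linarith
    then have 1: "((1 - k * \<rho> r) * \<eta> r + r * \<eta>' r)\<^sup>2 \<le> (a + 8)\<^sup>2" by (simp only: abs_le_square_iff)
    have "1\<^sup>2 \<le> r\<^sup>2" using that by (intro power_mono) auto
    then have "(\<epsilon>\<^sup>2 + r\<^sup>2) powr (- k) \<le> 1 powr (- k)"
      using a by (intro powr_mono2') (auto simp: k_def add_increasing)
    then have "(s r)\<^sup>2 \<le> 1" unfolding s2 by simp
    then have "(s r)\<^sup>2 * ((1 - k * \<rho> r) * \<eta> r + r * \<eta>' r)\<^sup>2 \<le> 1 * (a + 8)\<^sup>2"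
      using 1 by (intro mult_mono) auto
    moreover have "0 \<le> (s r)\<^sup>2 * (a\<^sup>2 * (\<eta> r)\<^sup>2)" by simp
    ultimately show ?thesis unfolding Eeq right_diff_distrib by linarith
  qed
  define c where "c = (f \<alpha> / (2 * real N))\<^sup>2 * (2 * \<epsilon>\<^sup>2) powr (- k)"
  define C where "C = 2 ^ (N - 1) * (2 ^ (N - 1) * M)\<^sup>2 * (a + 8)\<^sup>2"
  have iG: "G integrable_on {x..z}" if "0 \<le> x" "z \<le> 2" for x z
    by (rule integrable_continuous_real[OF continuous_on_subset[OF cG]]) (use that in auto)
  have split: "integral {0..2} G = integral {0..\<epsilon>} G + integral {\<epsilon>..1} G + integral {1..2} G"
    using Henstock_Kurzweil_Integration.integral_combine[of 0 1 2 G]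
      Henstock_Kurzweil_Integration.integral_combine[of 0 \<epsilon> 1 G] iG \<epsilon> by simp
  have "((\<lambda>r. - c * r ^ (N + 1)) has_integral (- c * (\<epsilon> ^ (N + 2) / real (N + 2)) - - c * (0 ^ (N + 2) / real (N + 2)))) {0..\<epsilon>}"
    using \<epsilon> by (intro fundamental_theorem_of_calculus)
      (auto intro!: derivative_eq_intros simp: has_real_derivative_iff_has_vector_derivative[symmetric] simp del: power_Suc)
  then have int1: "((\<lambda>r. - c * r ^ (N + 1)) has_integral (- c * (\<epsilon> ^ (N + 2) / real (N + 2)))) {0..\<epsilon>}" by simp
  have "integral {0..\<epsilon>} G \<le> integral {0..\<epsilon>} (\<lambda>r. - c * r ^ (N + 1))"
  proof (rule integral_le)
    show "G integrable_on {0..\<epsilon>}" using iG \<epsilon> by simp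
    show "(\<lambda>r. - c * r ^ (N + 1)) integrable_on {0..\<epsilon>}" using int1 by blast
    fix r assume r: "r \<in> {0..\<epsilon>}"
    have "f (U \<alpha> \<epsilon>) \<le> f (U \<alpha> r)"
      using r stable_U_pos[OF \<alpha> st, of \<epsilon>] \<epsilon> by (intro f_mono stable_U_antimono[OF \<alpha> st]) auto
    then have "f \<alpha> / 2 * r / real N \<le> V \<alpha> r" using r low by (intro stable_V_ge[OF \<alpha> st]) auto
    then have "f \<alpha> / (2 * real N) * r \<le> V \<alpha> r" by simp
    then have "(f \<alpha> / (2 * real N) * r)\<^sup>2 \<le> (V \<alpha> r)\<^sup>2"
      using r f_pos[OF \<alpha>] by (intro power_mono) auto
    then have "r ^ (N - 1) * (f \<alpha> / (2 * real N) * r)\<^sup>2 * (2 * \<epsilon>\<^sup>2) powr (- k) \<le> r ^ (N - 1) * (V \<alpha> r)\<^sup>2 * (- E r)"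
      using E1[of r] r by (intro mult_mono mult_left_mono) auto
    moreover have "r ^ (N - 1) * (f \<alpha> / (2 * real N) * r)\<^sup>2 * (2 * \<epsilon>\<^sup>2) powr (- k) = c * (r ^ (N - 1) * r\<^sup>2)"
      unfolding c_def power_mult_distrib[of _ r] by (simp only: mult_ac)
    moreover have "r ^ (N - 1) * r\<^sup>2 = r ^ (N + 1)" using N by (simp flip: power_add)
    ultimately have "c * r ^ (N + 1) \<le> r ^ (N - 1) * (V \<alpha> r)\<^sup>2 * (- E r)" by (simp only:)
    then show "G r \<le> - c * r ^ (N + 1)" unfolding G_def mult_minus_left mult_minus_right by linarith
  qed
  also have "\<dots> = - c * (\<epsilon> ^ (N + 2) / real (N + 2))" using int1 by (rule integral_unique)
  finally have i1: "integral {0..\<epsilon>} G \<le> - c * (\<epsilon> ^ (N + 2) / real (N + 2))" .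
  have "integral {\<epsilon>..1} G \<le> integral {\<epsilon>..1} (\<lambda>r. 0)"
  proof (rule integral_le)
    show "G integrable_on {\<epsilon>..1}" using iG \<epsilon> by simp
    show "G r \<le> 0" if "r \<in> {\<epsilon>..1}" for r
      unfolding G_def using E0[of r] that \<epsilon> by (intro mult_nonneg_nonpos) auto
  qed (rule integrable_0)
  then have i2: "integral {\<epsilon>..1} G \<le> 0" by simp
  have "integral {1..2} G \<le> integral {1..2::real} (\<lambda>r. C)"
  proof (rule integral_le)
    show "G integrable_on {1..2}" using iG by simp
    fix r :: real assume r: "r \<in> {1..2}"
    have "V \<alpha> r \<le> 2 ^ (N - 1) * U \<alpha> 1" using stable_V_outer[OF \<alpha> st] r by simp
    also have "\<dots> \<le> 2 ^ (N - 1) * M" using M by simp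
    finally have "(V \<alpha> r)\<^sup>2 \<le> (2 ^ (N - 1) * M)\<^sup>2"
      using stable_V_nonneg[OF \<alpha> st, of r] r by (intro power_mono) auto
    then have "r ^ (N - 1) * (V \<alpha> r)\<^sup>2 \<le> 2 ^ (N - 1) * (2 ^ (N - 1) * M)\<^sup>2"
      using r power_mono[of r 2 "N - 1"] by (intro mult_mono) auto
    moreover have "G r \<le> r ^ (N - 1) * (V \<alpha> r)\<^sup>2 * (a + 8)\<^sup>2"
      unfolding G_def using E2[of r] r by (intro mult_left_mono) auto
    ultimately show "G r \<le> C" unfolding C_def by (smt (verit, best) mult_right_mono zero_le_power2)
  qed (intro integrable_continuous_real continuous_intros)
  then have i3: "integral {1..2} G \<le> C" by simp
  have "c * (\<epsilon> ^ (N + 2) / real (N + 2)) \<le> C" using i1 i2 i3 split \<open>0 \<le> integral {0..2} G\<close> by linarith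
  then show ?thesis unfolding c_def C_def k_def .
qed

end

context radial_problem begin

text \<open>With \<epsilon>^2 = c F(\<alpha>) the left-hand side of the estimate becomes D
  (f(\<alpha>) F(\<alpha>)^q_JL)^2, which is unbounded by \<open>f_F_powr_at_top\<close>, while the
  right-hand side C is fixed.\<close>

lemma not_radially_stable_large:
  assumes lim: "((\<lambda>u. deriv f u * F u) \<longlongrightarrow> q) at_top" and q: "q_JL N < q"
  obtains A where "A > 0" "\<And>\<alpha>. \<alpha> > A \<Longrightarrow> \<not> radially_stable \<alpha>"
proof -
  define a where "a = sqrt (real N - 1)"
  have a2: "a\<^sup>2 = real N - 1" using N by (simp add: a_def)
  have JL: "q_JL N = (real N - 2 * a) / 4" by (simp add: q_JL_def a_def)
  \<comment> \<open>Only the sign of q_JL is wanted: it gives q > 0, hence c > 0.\<close>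
  have "(a - 1)\<^sup>2 = 4 * q_JL N" unfolding JL using a2 by (simp add: power2_eq_square algebra_simps)
  then have "4 * q_JL N \<ge> 0" by (metis zero_le_power2)
  then have q0: "q > 0" using q by simp
  \<comment> \<open>As f'(\<alpha>) F(\<alpha>) < q + 1 eventually, f drops on [0, \<epsilon>] by at
    most f(\<alpha>) (q+1) c / (2 N); this c makes that exactly f(\<alpha>)/2.\<close>
  define c where "c = real N / (q + 1)"
  have c: "c > 0" using N q0 by (simp add: c_def)
  have Np: "real N > 0" using N by simp
  have "\<forall>\<^sub>F u in at_top. F u < 1 / (2 * real N) \<and> u > 0"
    using Np by (intro eventually_conj order_tendstoD(2)[OF F_tendsto_0] eventually_gt_at_top) simp
  \<comment> \<open>F(U \<alpha> 1) >= 1/(2N) > F(M) forces U \<alpha> 1 <= M, whatever \<alpha>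
    is.\<close>
  then obtain M where M: "F M < 1 / (2 * real N)" "M > 0" using eventually_happens' trivial_limit_at_top_linorder by fastforce
  define C where "C = 2 ^ (N - 1) * (2 ^ (N - 1) * M)\<^sup>2 * (a + 8)\<^sup>2"
  define D where "D = c powr (2 * q_JL N) * 2 powr (- (a + 1)) / (4 * (real N)\<^sup>2 * real (N + 2))"
  have D: "D > 0" using c N by (simp add: D_def)
  have C: "C \<ge> 0" by (simp add: C_def)
  \<comment> \<open>The bound f' F < q + 1 keeps f(u) above f(\<alpha>)/2, F < 1/c gives \<epsilon>
    <= 1, and the last inequality yields the contradiction, because (C/D + 1)^2 >= C/D.\<close>
  have "\<forall>\<^sub>F u in at_top. u > 0 \<and> deriv f u * F u < q + 1 \<and> F u < 1 / c \<and> C / D + 1 < f u * F u powr q_JL N"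
    using c by (intro eventually_conj eventually_gt_at_top order_tendstoD(2)[OF lim] order_tendstoD(2)[OF F_tendsto_0]
      filterlim_at_top_dense[THEN iffD1, rule_format] f_F_powr_at_top[OF lim q]) auto
  then obtain A where A: "\<And>u. u \<ge> A \<Longrightarrow> u > 0 \<and> deriv f u * F u < q + 1 \<and> F u < 1 / c \<and> C / D + 1 < f u * F u powr q_JL N"
    by (auto simp: eventually_at_top_linorder)
  have "\<not> radially_stable \<alpha>" if "\<alpha> > A" for \<alpha>
  proof
    assume st: "radially_stable \<alpha>"
    have \<alpha>: "\<alpha> > 0" "deriv f \<alpha> * F \<alpha> < q + 1" "F \<alpha> < 1 / c" "C / D + 1 < f \<alpha> * F \<alpha> powr q_JL N"
      using A[of \<alpha>] that by auto
    define \<epsilon> where "\<epsilon> = sqrt (c * F \<alpha>)"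
    have cF: "c * F \<alpha> > 0" using c F_pos[OF \<alpha>(1)] by simp
    have \<epsilon>2: "\<epsilon>\<^sup>2 = c * F \<alpha>" using cF by (simp add: \<epsilon>_def)
    have \<epsilon>: "0 < \<epsilon>" "\<epsilon> \<le> 1" using cF \<alpha>(3) c by (auto simp: \<epsilon>_def field_simps)
    have U\<epsilon>: "0 < U \<alpha> \<epsilon>" "U \<alpha> \<epsilon> \<le> \<alpha>"
      using stable_U_pos[OF \<alpha>(1) st, of \<epsilon>] U_abs_le[OF \<alpha>(1), of \<epsilon>] \<epsilon> by auto
    have "f \<alpha> - f (U \<alpha> \<epsilon>) \<le> deriv f \<alpha> * (\<alpha> - U \<alpha> \<epsilon>)"
      using f_diff_less[of "U \<alpha> \<epsilon>" \<alpha>] U\<epsilon> by (cases "U \<alpha> \<epsilon> = \<alpha>") auto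
    also have "\<dots> \<le> deriv f \<alpha> * (f \<alpha> * \<epsilon>\<^sup>2 / (2 * real N))"
      using stable_U_ge[OF \<alpha>(1) st, of \<epsilon>] \<epsilon> by (intro mult_left_mono deriv_f_nonneg) auto
    also have "\<dots> = (deriv f \<alpha> * F \<alpha>) * (f \<alpha> * (c / (2 * real N)))" unfolding \<epsilon>2 by simp
    also have "\<dots> \<le> (q + 1) * (f \<alpha> * (c / (2 * real N)))"
      using \<alpha>(2) f_pos[OF \<alpha>(1)] c Np by (intro mult_right_mono) auto
    also have "\<dots> = f \<alpha> * ((q + 1) * c) / (2 * real N)" by simp
    also have "(q + 1) * c = real N" using q0 by (simp add: c_def)
    also have "f \<alpha> * real N / (2 * real N) = f \<alpha> / 2" using Np by simp
    finally have low: "f \<alpha> / 2 \<le> f (U \<alpha> \<epsilon>)" by simp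
    have "U \<alpha> 1 \<le> M"
    proof (rule ccontr)
      assume "\<not> U \<alpha> 1 \<le> M"
      then have "F (U \<alpha> 1) < F M" using M by (intro F_strict_antimono) auto
      then show False using stable_F_U_ge[OF \<alpha>(1) st, of 1] M by simp
    qed
    from radially_stable_estimate[OF \<alpha>(1) st \<epsilon> low this]
    have est: "(f \<alpha> / (2 * real N))\<^sup>2 * (2 * \<epsilon>\<^sup>2) powr (- (a + 1)) * (\<epsilon> ^ (N + 2) / real (N + 2)) \<le> C"
      unfolding C_def a_def .
    have "(2 * \<epsilon>\<^sup>2) powr (- (a + 1)) * \<epsilon> ^ (N + 2) = 2 powr (- (a + 1)) * (c powr (2 * q_JL N) * (F \<alpha> powr q_JL N)\<^sup>2)"
    proof -
      have ep: "(\<epsilon>\<^sup>2) powr x = \<epsilon> powr (2 * x)" for x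
      proof -
        have "\<epsilon>\<^sup>2 = \<epsilon> powr 2" using \<epsilon> by simp
        then show ?thesis by (simp only: powr_powr)
      qed
      have "(2 * \<epsilon>\<^sup>2) powr (- (a + 1)) * \<epsilon> ^ (N + 2) = (2 powr (- (a + 1)) * (\<epsilon>\<^sup>2) powr (- (a + 1))) * \<epsilon> powr real (N + 2)"
        unfolding powr_realpow[OF \<epsilon>(1)] by (simp only: powr_mult)
      also have "\<dots> = 2 powr (- (a + 1)) * (\<epsilon> powr (2 * - (a + 1)) * \<epsilon> powr real (N + 2))"
        unfolding ep by (simp only: mult.assoc)
      also have "\<epsilon> powr (2 * - (a + 1)) * \<epsilon> powr real (N + 2) = \<epsilon> powr (2 * (2 * q_JL N))"
      proof -
        \<comment> \<open>The exponent of \<epsilon> is N - 2a = 4 q_JL: here the critical exponent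
          enters.\<close>
        have "2 * - (a + 1) + real (N + 2) = 2 * (2 * q_JL N)" unfolding JL by simp
        then show ?thesis by (simp only: powr_add[symmetric])
      qed
      also have "\<dots> = (\<epsilon>\<^sup>2) powr (2 * q_JL N)" by (simp only: ep)
      also have "\<dots> = c powr (2 * q_JL N) * F \<alpha> powr (2 * q_JL N)"
        unfolding \<epsilon>2 using c F_pos[OF \<alpha>(1)] by (simp add: powr_mult)
      also have "F \<alpha> powr (2 * q_JL N) = (F \<alpha> powr q_JL N)\<^sup>2"
        by (simp add: power2_eq_square powr_add[symmetric])
      finally show ?thesis .
    qed
    then have "(f \<alpha> / (2 * real N))\<^sup>2 * (2 * \<epsilon>\<^sup>2) powr (- (a + 1)) * (\<epsilon> ^ (N + 2) / real (N + 2))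
      = (f \<alpha> / (2 * real N))\<^sup>2 * (2 powr (- (a + 1)) * (c powr (2 * q_JL N) * (F \<alpha> powr q_JL N)\<^sup>2)) / real (N + 2)"
      by (metis (no_types, lifting) mult.assoc times_divide_eq_right)
    also have "\<dots> = D * (f \<alpha> * F \<alpha> powr q_JL N)\<^sup>2"
      unfolding D_def by (simp add: power_mult_distrib power_divide)
    finally have "(f \<alpha> * F \<alpha> powr q_JL N)\<^sup>2 \<le> C / D" using est D by (simp add: field_simps)
    moreover have "C / D \<ge> 0" using C D by simp
    then have "(C / D + 1)\<^sup>2 < (f \<alpha> * F \<alpha> powr q_JL N)\<^sup>2"
      using \<alpha>(4) by (intro power_strict_mono) auto
    moreover have "x \<le> (x + 1)\<^sup>2" if "x \<ge> 0" for x :: real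
      using that mult_nonneg_nonneg[OF that that] by (simp add: power2_eq_square algebra_simps)
    from this[OF \<open>C / D \<ge> 0\<close>] have "C / D \<le> (C / D + 1)\<^sup>2" .
    ultimately show False by linarith
  qed
  then show ?thesis using that[of "max A 1"] by simp
qed

end

section \<open>Stability in the full space as a function of the initial value\<close>

lemma C1_compact_support_gradient_zero:
  fixes \<phi> :: "real^'n \<Rightarrow> real"
  assumes "C1_compact_support \<phi> g" "x \<notin> closure {x. \<phi> x \<noteq> 0}"
  shows "g x = 0"
proof -
  let ?S = "- closure {x. \<phi> x \<noteq> 0}"
  have 0: "\<phi> y = 0" if "y \<in> ?S" for y using that closure_subset[of "{x. \<phi> x \<noteq> 0}"] by auto
  have "(\<phi> has_derivative (\<lambda>h. h \<bullet> g x)) (at x)"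
    using assms(1) by (simp add: C1_compact_support_def gderiv_def)
  moreover have "(\<phi> has_derivative (\<lambda>_. 0)) (at x)"
  proof (rule has_derivative_transform_within_open)
    show "((\<lambda>_. 0) has_derivative (\<lambda>_. 0)) (at x)" by (rule has_derivative_const)
    show "open ?S" "x \<in> ?S" using assms(2) by auto
    show "0 = \<phi> y" if "y \<in> ?S" for y using 0[OF that] by (rule sym)
  qed
  ultimately have "(\<lambda>h. h \<bullet> g x) = (\<lambda>_. 0)" by (rule has_derivative_unique)
  from fun_cong[OF this, of "g x"] have "g x \<bullet> g x = 0" .
  then show ?thesis by simp
qed

lemma C1_compact_support_integrable:
  fixes \<phi> :: "real^'n \<Rightarrow> real" and p :: "real^'n \<Rightarrow> real"
  assumes "C1_compact_support \<phi> g" "continuous_on UNIV p"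
  shows "integrable lborel (\<lambda>x. (norm (g x))\<^sup>2 - p x * (\<phi> x)\<^sup>2)"
proof -
  let ?K = "closure {x. \<phi> x \<noteq> 0}"
  have "continuous_on UNIV \<phi>"
    using assms(1) by (auto simp: C1_compact_support_def gderiv_def intro!: continuous_at_imp_continuous_on has_derivative_continuous)
  then have "continuous_on ?K (\<lambda>x. (norm (g x))\<^sup>2 - p x * (\<phi> x)\<^sup>2)"
    using assms by (intro continuous_intros) (auto simp: C1_compact_support_def intro: continuous_on_subset)
  then have "integrable lborel (\<lambda>x. indicator ?K x *\<^sub>R ((norm (g x))\<^sup>2 - p x * (\<phi> x)\<^sup>2))"
    using assms(1) by (intro borel_integrable_compact) (auto simp: C1_compact_support_def)
  moreover have "indicator ?K x *\<^sub>R ((norm (g x))\<^sup>2 - p x * (\<phi> x)\<^sup>2) = (norm (g x))\<^sup>2 - p x * (\<phi> x)\<^sup>2" for x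
    using C1_compact_support_gradient_zero[OF assms(1), of x] closure_subset[of "{x. \<phi> x \<noteq> 0}"]
    by (auto simp: indicator_def)
  ultimately show ?thesis by (simp only:)
qed

context radial_problem begin

context
  assumes card: "CARD('n::finite) = N"
begin

abbreviation sol :: "real \<Rightarrow> real^'n \<Rightarrow> real" where "sol \<alpha> \<equiv> radial_fun f \<alpha>"

lemma sol_eq: "sol \<alpha> = (\<lambda>x. U \<alpha> (norm x))"
  by (simp add: radial_fun_def card fun_eq_iff)

lemma stable_imp_radially_stable:
  assumes "\<alpha> > 0" "stable f (sol \<alpha>)"
  shows "radially_stable \<alpha>"
  unfolding radially_stable_def
  using stable_radial_test[OF assms(2)[unfolded sol_eq] continuous_dfU[OF assms(1)]] card by auto

lemma continuous_deriv_f_sol: "\<alpha> > 0 \<Longrightarrow> continuous_on UNIV (\<lambda>x. deriv f (sol \<alpha> x))"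
  unfolding sol_eq by (intro continuous_on_compose2[OF continuous_dfU] continuous_intros) auto

text \<open>The ordering 0 < U \<beta> < U \<alpha> and monotonicity of f' lower the potential
  pointwise, so the form increases for every test function, radial or not.\<close>

lemma stable_downward:
  assumes "stable f (sol \<alpha>)" "0 < \<beta>" "\<beta> < \<alpha>"
  shows "stable f (sol \<beta>)"
  unfolding stable_def
proof (intro allI impI)
  fix \<phi> :: "real^'n \<Rightarrow> real" and g assume t: "C1_compact_support \<phi> g"
  have \<alpha>: "\<alpha> > 0" using assms by simp
  have "0 \<le> (LBINT x. (norm (g x))\<^sup>2 - deriv f (sol \<alpha> x) * (\<phi> x)\<^sup>2)"
    using assms(1) t by (simp add: stable_def)
  also have "\<dots> \<le> (LBINT x. (norm (g x))\<^sup>2 - deriv f (sol \<beta> x) * (\<phi> x)\<^sup>2)"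
  proof (rule integral_mono)
    fix x :: "real^'n"
    have "deriv f (sol \<beta> x) \<le> deriv f (sol \<alpha> x)"
      using radially_stable_order[OF stable_imp_radially_stable[OF \<alpha> assms(1)] assms(2,3), of "norm x"]
      unfolding sol_eq by (intro deriv_f_mono) auto
    then show "(norm (g x))\<^sup>2 - deriv f (sol \<alpha> x) * (\<phi> x)\<^sup>2 \<le> (norm (g x))\<^sup>2 - deriv f (sol \<beta> x) * (\<phi> x)\<^sup>2"
      by (simp add: mult_right_mono)
  qed (intro C1_compact_support_integrable[OF t] continuous_deriv_f_sol \<alpha> assms(2))+
  finally show "0 \<le> (LBINT x. (norm (g x))\<^sup>2 - deriv f (sol \<beta> x) * (\<phi> x)\<^sup>2)" .
qed

text \<open>Dominated convergence for each fixed test function: all solutions involved are bounded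
  by \<alpha>, so f' of them is at most f'(\<alpha>).\<close>

lemma stable_limit:
  assumes a: "a \<longlonglongrightarrow> \<alpha>" "\<And>n. 0 < a n" "\<And>n. a n \<le> \<alpha>" and st: "\<And>n. stable f (sol (a n))" and \<alpha>: "\<alpha> > 0"
  shows "stable f (sol \<alpha>)"
  unfolding stable_def
proof (intro allI impI)
  fix \<phi> :: "real^'n \<Rightarrow> real" and g assume t: "C1_compact_support \<phi> g"
  have "(\<lambda>n. LBINT x. (norm (g x))\<^sup>2 - deriv f (sol (a n) x) * (\<phi> x)\<^sup>2)
    \<longlonglongrightarrow> (LBINT x. (norm (g x))\<^sup>2 - deriv f (sol \<alpha> x) * (\<phi> x)\<^sup>2)"
  \<comment> \<open>The majorant is |g|^2 + f'(\<alpha>) \<phi>^2, written with a double minus to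
    match \<open>C1_compact_support_integrable\<close>.\<close>
  proof (rule integral_dominated_convergence[where w="\<lambda>x. (norm (g x))\<^sup>2 - (- deriv f \<alpha>) * (\<phi> x)\<^sup>2"])
    show "integrable lborel (\<lambda>x. (norm (g x))\<^sup>2 - (- deriv f \<alpha>) * (\<phi> x)\<^sup>2)"
      by (intro C1_compact_support_integrable[OF t] continuous_intros)
    show "(\<lambda>x. (norm (g x))\<^sup>2 - deriv f (sol \<alpha> x) * (\<phi> x)\<^sup>2) \<in> borel_measurable lborel"
      "(\<lambda>x. (norm (g x))\<^sup>2 - deriv f (sol (a n) x) * (\<phi> x)\<^sup>2) \<in> borel_measurable lborel" for n
      by (intro borel_measurable_integrable C1_compact_support_integrable[OF t] continuous_deriv_f_sol \<alpha> a)+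
    show "AE x in lborel. (\<lambda>n. (norm (g x))\<^sup>2 - deriv f (sol (a n) x) * (\<phi> x)\<^sup>2)
      \<longlonglongrightarrow> (norm (g x))\<^sup>2 - deriv f (sol \<alpha> x) * (\<phi> x)\<^sup>2"
    proof (rule AE_I2)
      fix x :: "real^'n"
      have "(\<lambda>n. sol (a n) x) \<longlonglongrightarrow> sol \<alpha> x" unfolding sol_eq by (intro U_tendsto a \<alpha>) auto
      moreover have "isCont (deriv f) (sol \<alpha> x)"
        using continuous_deriv_f[of UNIV] by (simp add: continuous_on_eq_continuous_at)
      ultimately have "(\<lambda>n. deriv f (sol (a n) x)) \<longlonglongrightarrow> deriv f (sol \<alpha> x)"
        by (rule isCont_tendsto_compose[rotated])
      then show "(\<lambda>n. (norm (g x))\<^sup>2 - deriv f (sol (a n) x) * (\<phi> x)\<^sup>2)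
          \<longlonglongrightarrow> (norm (g x))\<^sup>2 - deriv f (sol \<alpha> x) * (\<phi> x)\<^sup>2" by (intro tendsto_intros)
    qed
    fix n
    show "AE x in lborel. norm ((norm (g x))\<^sup>2 - deriv f (sol (a n) x) * (\<phi> x)\<^sup>2) \<le> (norm (g x))\<^sup>2 - (- deriv f \<alpha>) * (\<phi> x)\<^sup>2"
    proof (rule AE_I2)
      fix x :: "real^'n"
      have "deriv f (sol (a n) x) \<le> deriv f \<alpha>"
        using U_abs_le[OF a(2)[of n], of "norm x"] a(3)[of n] unfolding sol_eq by (intro deriv_f_mono) auto
      then have "0 \<le> deriv f (sol (a n) x) * (\<phi> x)\<^sup>2" "deriv f (sol (a n) x) * (\<phi> x)\<^sup>2 \<le> deriv f \<alpha> * (\<phi> x)\<^sup>2"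
        using deriv_f_nonneg by (auto intro: mult_right_mono)
      then show "norm ((norm (g x))\<^sup>2 - deriv f (sol (a n) x) * (\<phi> x)\<^sup>2) \<le> (norm (g x))\<^sup>2 - (- deriv f \<alpha>) * (\<phi> x)\<^sup>2"
        unfolding real_norm_def using zero_le_power2[of "norm (g x)"] by linarith
    qed
  qed
  then show "0 \<le> (LBINT x. (norm (g x))\<^sup>2 - deriv f (sol \<alpha> x) * (\<phi> x)\<^sup>2)"
    by (rule LIMSEQ_le_const) (use st t in \<open>auto simp: stable_def\<close>)
qed

text \<open>If some solution is stable, the threshold is the supremum of the stable values, finite
  because of A. \<open>stable_downward\<close> fills the interval below it,
  \<open>stable_limit\<close> adds the end point, and the ordering gives monotonicity.\<close>

lemma stability_dichotomy:
  assumes A: "A > 0" "\<And>\<alpha>. \<alpha> > A \<Longrightarrow> unstable f (sol \<alpha>)"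
  shows "(\<forall>\<alpha>>0. unstable f (sol \<alpha>)) \<or>
     (\<exists>\<alpha>s>0. (\<forall>\<alpha>\<in>{0<..\<alpha>s}. stable f (sol \<alpha>)) \<and> (\<forall>\<alpha>>\<alpha>s. unstable f (sol \<alpha>)) \<and>
        (\<forall>r>0. strict_mono_on {0<..<\<alpha>s} (\<lambda>\<alpha>. U \<alpha> r)))"
proof (cases "\<forall>\<alpha>>0. unstable f (sol \<alpha>)")
  case False
  define S where "S = {\<alpha>. \<alpha> > 0 \<and> stable f (sol \<alpha>)}"
  have S: "S \<noteq> {}" "bdd_above S"
    using False A by (auto simp: S_def intro!: bdd_aboveI[of _ A] simp flip: not_less)
  define s where "s = Sup S"
  have s0: "s > 0"
  proof -
    obtain \<alpha> where "\<alpha> \<in> S" using S by auto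
    then have "\<alpha> \<le> s" "\<alpha> > 0" using cSup_upper[OF _ S(2)] by (auto simp: s_def S_def)
    then show ?thesis by simp
  qed
  have below: "stable f (sol \<alpha>)" if \<alpha>: "0 < \<alpha>" "\<alpha> < s" for \<alpha>
  proof -
    obtain \<beta> where "\<beta> \<in> S" "\<alpha> < \<beta>" using less_cSupD[OF S(1) \<alpha>(2)[unfolded s_def]] by blast
    then show ?thesis using stable_downward[of \<beta> \<alpha>] \<alpha> by (auto simp: S_def)
  qed
  have at: "stable f (sol s)"
  proof (rule stable_limit)
    \<comment> \<open>The sequence stays in [s/2, s), so its members are positive and strictly below
      s.\<close>
    let ?a = "\<lambda>n. s - s / 2 * inverse (real (Suc n))"
    have "?a \<longlonglongrightarrow> s - s / 2 * 0" by (intro tendsto_intros LIMSEQ_inverse_real_of_nat)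
    then show "?a \<longlonglongrightarrow> s" by simp
    show pos: "0 < ?a n" for n
    proof -
      have "s / 2 * inverse (real (Suc n)) \<le> s / 2 * 1" using s0 by (intro mult_left_mono) (auto simp: field_simps)
      then show ?thesis using s0 by simp
    qed
    show "?a n \<le> s" for n using s0 by simp
    show "stable f (sol (?a n))" for n using s0 by (intro below pos) simp
  qed (rule s0)
  have "\<forall>\<alpha>\<in>{0<..s}. stable f (sol \<alpha>)" using below at by (metis greaterThanAtMost_iff order_le_less)
  moreover have "\<forall>\<alpha>>s. unstable f (sol \<alpha>)"
  proof (intro allI impI notI)
    fix \<alpha> assume "s < \<alpha>" "stable f (sol \<alpha>)"
    then have "\<alpha> \<in> S" using s0 by (simp add: S_def)
    then have "\<alpha> \<le> s" unfolding s_def using S(2) by (rule cSup_upper)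
    then show False using \<open>s < \<alpha>\<close> by simp
  qed
  moreover have "strict_mono_on {0<..<s} (\<lambda>\<alpha>. U \<alpha> r)" if "r > 0" for r
  proof (rule strict_mono_onI)
    fix \<beta> \<alpha> assume "\<beta> \<in> {0<..<s}" "\<alpha> \<in> {0<..<s}" "\<beta> < \<alpha>"
    then show "U \<beta> r < U \<alpha> r"
      using radially_stable_order[OF stable_imp_radially_stable[OF _ below], of \<alpha> \<beta> r] that by auto
  qed
  ultimately show ?thesis using s0 by blast
qed simp

end

end

theorem theorem1p6:
  fixes f :: "real \<Rightarrow> real" and q_inf :: real
  assumes "CARD('n::finite) \<ge> 11"
    and "standing_assumptions f"
    and "((\<lambda>u. deriv f u * F_int f u) \<longlongrightarrow> q_inf) at_top"
    and "q_inf > q_JL CARD('n)"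
  shows "(\<exists>\<alpha>h>0. \<forall>\<alpha>>\<alpha>h. unstable f (radial_fun f \<alpha> :: real ^ 'n \<Rightarrow> real)) \<and>
    ((\<forall>\<alpha>>0. unstable f (radial_fun f \<alpha> :: real ^ 'n \<Rightarrow> real)) \<or>
     (\<exists>\<alpha>s>0.
        (\<forall>\<alpha>\<in>{0<..\<alpha>s}. stable f (radial_fun f \<alpha> :: real ^ 'n \<Rightarrow> real)) \<and>
        (\<forall>\<alpha>>\<alpha>s. unstable f (radial_fun f \<alpha> :: real ^ 'n \<Rightarrow> real)) \<and>
        (\<forall>r>0. strict_mono_on {0<..<\<alpha>s} (\<lambda>\<alpha>. radial_sol CARD('n) f \<alpha> r))))"
proof -
  interpret radial_problem "CARD('n)" f by standard fact+
  obtain A where A: "A > 0" "\<And>\<alpha>. \<alpha> > A \<Longrightarrow> \<not> radially_stable \<alpha>"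
    using not_radially_stable_large[OF assms(3,4)] by blast
  have unst: "unstable f (radial_fun f \<alpha> :: real ^ 'n \<Rightarrow> real)" if "\<alpha> > A" for \<alpha>
    using A that stable_imp_radially_stable[OF refl, of \<alpha>] by auto
  show ?thesis
  proof
    show "\<exists>\<alpha>h>0. \<forall>\<alpha>>\<alpha>h. unstable f (radial_fun f \<alpha> :: real ^ 'n \<Rightarrow> real)"
      using A(1) unst by blast
  qed (rule stability_dichotomy[OF refl A(1) unst])
qed

end
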